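(* Let $d\ge2$, $k\ge1$, and let $Cl^{(d)}_{1\to k}$ be the $1\to k$ universal qudit cloning channel, with isometric extension $U$ and complementary channel $\mathcal{S}^{(d)}_k$. For all $\lambda,\mu\ge0$, the private dynamic capacity formula $$P_{\lambda,\mu}(Cl^{(d)}_{1\to k})=\max_\omega\ I(YX;B)_\omega+\lambda\big[H(B|X)_\omega-H(E|X)_\omega\big]+\mu\big[H(B)_\omega-H(E|X)_\omega\big]$$ is maximized by an ensemble of the form $$\frac1d\sum_{x=1}^d|x\rangle\langle x|^X\otimes\psi_x^{YA'},\qquad \psi_x^{YA'}=\sum_{j=1}^dq_{(j-x)\bmod d}\,|j\rangle\langle j|^Y\otimes|j\rangle\langle j|^{A'},$$ for some $\nu_1,\dots,\nu_{d-1}\ge0$ with $\sum\nu_m\le1$, where $q_0=1-\nu_1-\dots-\nu_{d-1}$ and $q_m=\nu_m$ for $1\le m\le d-1$ (with the $A'$ system sent through $U$).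
   Context: The $1\to k$ universal qudit cloner is the isometry $U:|l\rangle\mapsto\sum_{\vec j\in N(k-1)}\sqrt{(1+j_l)/\binom{k+d-1}{d}}\,|\vec e_l+\vec j\rangle_B\otimes R_{\vec j}$, where $N(m)=\{\vec j\in\mathbb{Z}_{\ge0}^d:\sum j_i=m\}$, $|\vec m\rangle$ is the normalized completely symmetric $k$-qudit state with occupation vector $\vec m$, and $R_{\vec j}$ are orthonormal states of the environment $E$; $Cl^{(d)}_{1\to k}=\mathrm{Tr}_E\circ U$, $\mathcal{S}^{(d)}_k=\mathrm{Tr}_B\circ U$. In the formula, $\omega$ ranges over states $\omega^{XYBE}=\sum_{x,y}p_{X,Y}(x,y)|x\rangle\langle x|^X\otimes|y\rangle\langle y|^Y\otimes U(\psi_{x,y})U^\dagger$ with $\psi_{x,y}$ pure states of $A'$. *)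

theory Defs
  imports "Jordan_Normal_Form.Char_Poly" "HOL-Computational_Algebra.Polynomial"
begin

text \<open>A matrix on a finite index set I is a function rho :: 'a => 'a => complex
(only its values on I x I matter).  We turn it into a JNF matrix using an arbitrary
enumeration of I (entropy does not depend on this choice).\<close>

definition enum_set :: "'a set \<Rightarrow> 'a list" where
  "enum_set I = (SOME xs. distinct xs \<and> set xs = I)"

definition mat_on :: "'a set \<Rightarrow> ('a \<Rightarrow> 'a \<Rightarrow> complex) \<Rightarrow> complex mat" where
  "mat_on I rho = (let xs = enum_set I in
      mat (length xs) (length xs) (\<lambda>(i, j). rho (xs ! i) (xs ! j)))"

definition entr :: "real \<Rightarrow> real" where
  "entr t = (if t \<le> 0 then 0 else t * log 2 t)"

text \<open>H(rho) = - sum over the eigenvalues (with multiplicity, as roots of the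
characteristic polynomial) of lambda log lambda.  For density matrices the eigenvalues
are real and nonnegative.\<close>
definition vN_entropy :: "'a set \<Rightarrow> ('a \<Rightarrow> 'a \<Rightarrow> complex) \<Rightarrow> real" where
  "vN_entropy I rho = - (\<Sum>l\<in>#proots (char_poly (mat_on I rho)). entr (Re l))"

definition occ :: "nat \<Rightarrow> nat \<Rightarrow> (nat \<Rightarrow> nat) set" where
  "occ d m = {j. (\<forall>i\<ge>d. j i = 0) \<and> (\<Sum>i<d. j i) = m}"

text \<open>Amplitude <m|_B <R_j|_E U |l> where B is represented in the orthonormal basis
{|m>, m in occ d k} of the symmetric subspace and E in the basis {R_j, j in occ d (k-1)}.\<close>
definition cl_amp :: "nat \<Rightarrow> nat \<Rightarrow> nat \<Rightarrow> (nat \<Rightarrow> nat) \<Rightarrow> (nat \<Rightarrow> nat) \<Rightarrow> complex" where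
  "cl_amp d k l m j =
     (if l < d \<and> j \<in> occ d (k - 1) \<and> m = j(l := j l + 1)
      then complex_of_real (sqrt ((1 + real (j l)) / real ((k + d - 1) choose d)))
      else 0)"

definition cl_vec :: "nat \<Rightarrow> nat \<Rightarrow> (nat \<Rightarrow> complex) \<Rightarrow> (nat \<Rightarrow> nat) \<Rightarrow> (nat \<Rightarrow> nat) \<Rightarrow> complex" where
  "cl_vec d k psi m j = (\<Sum>l<d. psi l * cl_amp d k l m j)"

text \<open>Cl_{1->k}(|psi><psi|) = Tr_E U psi psi^* U^*, on the index set occ d k.\<close>
definition cloner_out :: "nat \<Rightarrow> nat \<Rightarrow> (nat \<Rightarrow> complex) \<Rightarrow> (nat \<Rightarrow> nat) \<Rightarrow> (nat \<Rightarrow> nat) \<Rightarrow> complex" where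
  "cloner_out d k psi m m' = (\<Sum>j\<in>occ d (k - 1). cl_vec d k psi m j * cnj (cl_vec d k psi m' j))"

text \<open>S_k(|psi><psi|) = Tr_B U psi psi^* U^*, on the index set occ d (k-1).\<close>
definition compl_out :: "nat \<Rightarrow> nat \<Rightarrow> (nat \<Rightarrow> complex) \<Rightarrow> (nat \<Rightarrow> nat) \<Rightarrow> (nat \<Rightarrow> nat) \<Rightarrow> complex" where
  "compl_out d k psi j j' = (\<Sum>m\<in>occ d k. cl_vec d k psi m j * cnj (cl_vec d k psi m j'))"

text \<open>An ensemble omega is given by a finite set S of pairs (x,y) of classical labels,
a probability distribution p on S and pure states psi x y of A' (unit vectors of C^d).\<close>
definition valid_ensemble :: "nat \<Rightarrow> (nat \<times> nat) set \<Rightarrow> (nat \<Rightarrow> nat \<Rightarrow> real)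
      \<Rightarrow> (nat \<Rightarrow> nat \<Rightarrow> nat \<Rightarrow> complex) \<Rightarrow> bool" where
  "valid_ensemble d S p psi \<longleftrightarrow> finite S \<and> (\<forall>(x, y)\<in>S. p x y \<ge> 0) \<and>
     (\<Sum>(x, y)\<in>S. p x y) = 1 \<and>
     (\<forall>(x, y)\<in>S. (\<forall>i\<ge>d. psi x y i = 0) \<and> (\<Sum>i<d. (cmod (psi x y i))\<^sup>2) = 1)"

definition marg_X :: "(nat \<times> nat) set \<Rightarrow> (nat \<Rightarrow> nat \<Rightarrow> real) \<Rightarrow> nat \<Rightarrow> real" where
  "marg_X S p x = (\<Sum>y\<in>{y. (x, y) \<in> S}. p x y)"

definition cond_state :: "(nat \<times> nat) set \<Rightarrow> (nat \<Rightarrow> nat \<Rightarrow> real) \<Rightarrow> (nat \<Rightarrow> nat \<Rightarrow> nat \<Rightarrow> complex)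
      \<Rightarrow> ((nat \<Rightarrow> complex) \<Rightarrow> 'b \<Rightarrow> 'b \<Rightarrow> complex) \<Rightarrow> nat \<Rightarrow> 'b \<Rightarrow> 'b \<Rightarrow> complex" where
  "cond_state S p psi ch x a b =
     (\<Sum>y\<in>{y. (x, y) \<in> S}. complex_of_real (p x y / marg_X S p x) * ch (psi x y) a b)"

definition avg_state :: "(nat \<times> nat) set \<Rightarrow> (nat \<Rightarrow> nat \<Rightarrow> real) \<Rightarrow> (nat \<Rightarrow> nat \<Rightarrow> nat \<Rightarrow> complex)
      \<Rightarrow> ((nat \<Rightarrow> complex) \<Rightarrow> 'b \<Rightarrow> 'b \<Rightarrow> complex) \<Rightarrow> 'b \<Rightarrow> 'b \<Rightarrow> complex" where
  "avg_state S p psi ch a b = (\<Sum>(x, y)\<in>S. complex_of_real (p x y) * ch (psi x y) a b)"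

definition H_B where
  "H_B d k S p psi = vN_entropy (occ d k) (avg_state S p psi (cloner_out d k))"

text \<open>H(B|X)_omega = sum_x p_X(x) H(rho^B_x)  (omega is classical on X)\<close>
definition H_B_X where
  "H_B_X d k S p psi = (\<Sum>x\<in>fst ` S. marg_X S p x *
       vN_entropy (occ d k) (cond_state S p psi (cloner_out d k) x))"

definition H_E_X where
  "H_E_X d k S p psi = (\<Sum>x\<in>fst ` S. marg_X S p x *
       vN_entropy (occ d (k - 1)) (cond_state S p psi (compl_out d k) x))"

definition I_XY_B where
  "I_XY_B d k S p psi = H_B d k S p psi -
       (\<Sum>(x, y)\<in>S. p x y * vN_entropy (occ d k) (cloner_out d k (psi x y)))"

definition pd_objective :: "nat \<Rightarrow> nat \<Rightarrow> real \<Rightarrow> real \<Rightarrow> (nat \<times> nat) set \<Rightarrow> (nat \<Rightarrow> nat \<Rightarrow> real)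
      \<Rightarrow> (nat \<Rightarrow> nat \<Rightarrow> nat \<Rightarrow> complex) \<Rightarrow> real" where
  "pd_objective d k lam mu S p psi =
      I_XY_B d k S p psi
      + lam * (H_B_X d k S p psi - H_E_X d k S p psi)
      + mu * (H_B d k S p psi - H_E_X d k S p psi)"

section \<open>The candidate optimal ensemble (0-based labels x, j in {0..<d})\<close>

definition q_weight :: "nat \<Rightarrow> (nat \<Rightarrow> real) \<Rightarrow> nat \<Rightarrow> real" where
  "q_weight d \<nu> m = (if m = 0 then 1 - (\<Sum>i\<in>{1..<d}. \<nu> i) else \<nu> m)"

definition opt_S :: "nat \<Rightarrow> (nat \<times> nat) set" where
  "opt_S d = {0..<d} \<times> {0..<d}"

definition opt_p :: "nat \<Rightarrow> (nat \<Rightarrow> real) \<Rightarrow> nat \<Rightarrow> nat \<Rightarrow> real" where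
  "opt_p d \<nu> x j = q_weight d \<nu> (nat ((int j - int x) mod int d)) / real d"

definition opt_psi :: "nat \<Rightarrow> nat \<Rightarrow> nat \<Rightarrow> complex" where
  "opt_psi x j = (\<lambda>i. if i = j then 1 else 0)"

end

theory Submission
  imports Defs "Jordan_Normal_Form.Schur_Decomposition" "HOL-Analysis.Function_Topology"
    "HOL-Real_Asymp.Real_Asymp"
begin

text \<open>In the occupation number representation the isometry sends the basis state l to a multiple of the
sum over j of (creation operator of l applied to j) tensor j. For an input with eigenvectors v i and
eigenvalues q i, the Fock basis built from the modes v i diagonalizes both channel outputs, so all output
entropies depend only on the spectrum q. Hence the objective splits: the entropy of the average output of
B is largest for the uniform spectrum (by concavity and the symmetry of the modes), the outputs of pure
states all have the same entropy, and each conditional term is at most the maximum of a continuous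
function of q on the simplex. Taking q to be a maximizer and permuting it cyclically over the
computational basis attains all the bounds at once, since the average input is then maximally mixed.\<close>

subsection \<open>Bosonic Fock space\<close>

text \<open>Why number states diagonalize both outputs: let C be the binomial coefficient of k+d-1
  over d, and let a(psi) be the annihilation operator of mode psi with adjoint a*(psi). A pure input
  psi gives a*(psi) a(psi) / C on k particles in B, and the transpose of a(psi) a*(psi) / C on k-1
  particles in E. The canonical commutation relation turns the second operator into the first kind
  plus the identity. For orthonormal modes all these number operators are diagonal in one common
  basis, so mixtures need no representation theory of the unitary group. The obstacle is the sign of
  H(E|X). The conditional part lam H(B|X) - (lam+mu) H(E|X) is a difference of entropies, so
  concavity does not locate its maximum. Hence B and E must be described by the same spectrum for
  each label x, and the weights come from compactness of the simplex instead of a closed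
  formula.\<close>

definition cinner_on :: "'a set \<Rightarrow> ('a \<Rightarrow> complex) \<Rightarrow> ('a \<Rightarrow> complex) \<Rightarrow> complex" where
  "cinner_on I f g = (\<Sum>j\<in>I. cnj (f j) * g j)"

text \<open>Functions stand for amplitudes with respect to number states. As a_l sends |m> to
  sqrt(m_l) |m - e_l>, the new amplitude at j is read off from \<open>f\<close> at j + e_l. The
  operator is conjugate linear in \<open>v\<close>.\<close>

definition annihilate :: "nat \<Rightarrow> (nat \<Rightarrow> complex) \<Rightarrow> ((nat \<Rightarrow> nat) \<Rightarrow> complex) \<Rightarrow> (nat \<Rightarrow> nat) \<Rightarrow> complex" where
  "annihilate d v f j = (\<Sum>l<d. cnj (v l) * sqrt (1 + real (j l)) * f (j(l := j l + 1)))"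

text \<open>Natural subtraction is harmless here: where \<open>m l = 0\<close> the update leaves m
  unchanged, but the factor sqrt 0 removes the term.\<close>

definition create :: "nat \<Rightarrow> (nat \<Rightarrow> complex) \<Rightarrow> ((nat \<Rightarrow> nat) \<Rightarrow> complex) \<Rightarrow> (nat \<Rightarrow> nat) \<Rightarrow> complex" where
  "create d v f m = (\<Sum>l<d. v l * sqrt (real (m l)) * f (m(l := m l - 1)))"

lemma annihilate_sum:
  "annihilate d v (\<lambda>j. \<Sum>i\<in>I. c i * f i j) j = (\<Sum>i\<in>I. c i * annihilate d v (f i) j)"
  unfolding annihilate_def sum_distrib_left by (subst sum.swap) (simp add: mult_ac)

lemma create_scale: "create d v (\<lambda>j. c * f j) j = c * create d v f j"
  unfolding create_def sum_distrib_left by (simp add: mult_ac)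

text \<open>This is the relation [a(u), a*(v)] = <u,v>, the source of the 1 in the eigenvalues on E
  and of the recursion for number states.\<close>

lemma canonical_commutation:
  "annihilate d u (create d v f) j = create d v (annihilate d u f) j + cinner_on {..<d} u v * f j"
proof -
  have "annihilate d u (create d v f) j = (\<Sum>l<d. \<Sum>l'<d. cnj (u l) * sqrt (1 + real (j l)) *
     (v l' * sqrt (real ((j(l := j l + 1)) l')) * f ((j(l := j l + 1))(l' := (j(l := j l + 1)) l' - 1))))"
    unfolding annihilate_def create_def sum_distrib_left by simp
  also have "\<dots> = (\<Sum>l<d. \<Sum>l'<d. v l' * sqrt (real (j l')) * (cnj (u l) * sqrt (1 + real ((j(l' := j l' - 1)) l)) *
       f ((j(l' := j l' - 1))(l := (j(l' := j l' - 1)) l + 1))) + (if l' = l then cnj (u l) * v l * f j else 0))"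
  proof (intro sum.cong refl)
    fix l l'
    have sq: "complex_of_real (sqrt (1 + real (j l))) * complex_of_real (sqrt (1 + real (j l))) = 1 + of_nat (j l)"
      by (simp flip: of_real_mult)
    have sq': "complex_of_real (sqrt (real (j l))) * complex_of_real (sqrt (real (j l))) = of_nat (j l)"
      by (simp flip: of_real_mult)
    show "cnj (u l) * sqrt (1 + real (j l)) *
        (v l' * sqrt (real ((j(l := j l + 1)) l')) * f ((j(l := j l + 1))(l' := (j(l := j l + 1)) l' - 1))) =
       v l' * sqrt (real (j l')) * (cnj (u l) * sqrt (1 + real ((j(l' := j l' - 1)) l)) *
       f ((j(l' := j l' - 1))(l := (j(l' := j l' - 1)) l + 1))) + (if l' = l then cnj (u l) * v l * f j else 0)"
    \<comment> \<open>Distinct modes commute. For equal modes, creating first gives the factor 1 + j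
      l and annihilating first gives j l; the difference 1 is the Kronecker term.\<close>
    proof (cases "l' = l")
      case True
      have "cnj (u l) * sqrt (1 + real (j l)) * (v l * sqrt (1 + real (j l)) * f j)
          = cnj (u l) * v l * f j * (1 + of_nat (j l))"
        unfolding sq[symmetric] by (simp add: mult_ac)
      moreover have "v l * sqrt (real (j l)) * (cnj (u l) * sqrt (1 + real (j l - 1)) * f (j(l := j l - 1 + 1)))
          = cnj (u l) * v l * f j * of_nat (j l)"
      proof (cases "j l")
        case (Suc n)
        then have "1 + real (j l - 1) = real (j l)" "j(l := j l - 1 + 1) = j" by auto
        then show ?thesis unfolding sq'[symmetric] by (simp add: mult_ac)
      qed simp
      moreover have "j(l := j l + 1 - 1) = j" "real (j l + 1) = 1 + real (j l)" by simp_all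
      ultimately show ?thesis
        unfolding True fun_upd_same fun_upd_upd if_P[OF refl] by (simp only: distrib_left mult_1_right add.commute)
    next
      case False
      then show ?thesis by (simp add: fun_upd_twist mult_ac)
    qed
  qed
  also have "\<dots> = create d v (annihilate d u f) j + cinner_on {..<d} u v * f j"
    unfolding annihilate_def create_def cinner_on_def sum_distrib_left sum_distrib_right sum.distrib
    by (subst sum.swap) simp
  finally show ?thesis .
qed

section \<open>Occupation vectors and the adjointness of creation and annihilation\<close>

lemma occ_eq_0: "occ d 0 = {\<lambda>_. 0}"
proof -
  have "j = (\<lambda>_. 0)" if "\<forall>i\<ge>d. j i = 0" "(\<Sum>i<d. j i) = 0" for j :: "nat \<Rightarrow> nat"
    using that by (metis (no_types, lifting) ext finite_lessThan lessThan_iff not_le sum_eq_0_iff)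
  then show ?thesis by (auto simp: occ_def)
qed

lemma finite_occ [simp]: "finite (occ d n)"
proof (rule finite_subset)
  show "occ d n \<subseteq> {j. \<forall>x. (x \<in> {..<d} \<longrightarrow> j x \<in> {..n}) \<and> (x \<notin> {..<d} \<longrightarrow> j x = 0)}"
  proof
    fix j assume j: "j \<in> occ d n"
    have "j x \<le> n" if "x < d" for x
      using member_le_sum[of x "{..<d}" j] that j by (simp add: occ_def)
    then show "j \<in> {j. \<forall>x. (x \<in> {..<d} \<longrightarrow> j x \<in> {..n}) \<and> (x \<notin> {..<d} \<longrightarrow> j x = 0)}"
      using j by (auto simp: occ_def)
  qed
  show "finite {j. \<forall>x. (x \<in> {..<d} \<longrightarrow> j x \<in> {..n}) \<and> (x \<notin> {..<d} \<longrightarrow> j x = (0::nat))}"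
    by (rule finite_set_of_finite_funs) auto
qed

lemma sum_fun_upd_nat:
  fixes j :: "nat \<Rightarrow> nat"
  assumes "l < d"
  shows "(\<Sum>i<d. (j(l := a)) i) + j l = (\<Sum>i<d. j i) + a"
proof -
  have "(\<Sum>i<d. (j(l := a)) i) = a + (\<Sum>i\<in>{..<d} - {l}. j i)"
    using assms by (subst sum.remove[of _ l]) auto
  moreover have "(\<Sum>i<d. j i) = j l + (\<Sum>i\<in>{..<d} - {l}. j i)"
    using assms by (subst sum.remove[of _ l]) auto
  ultimately show ?thesis by simp
qed

lemma occ_raise:
  assumes "l < d" "j \<in> occ d n"
  shows "j(l := j l + 1) \<in> occ d (Suc n)"
  using assms sum_fun_upd_nat[OF assms(1), of j "j l + 1"] by (auto simp: occ_def)

lemma occ_lower: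
  assumes "l < d" "m \<in> occ d (Suc n)" "m l \<noteq> 0"
  shows "m(l := m l - 1) \<in> occ d n"
  using assms sum_fun_upd_nat[OF assms(1), of m "m l - 1"] by (auto simp: occ_def)

text \<open>Only vectors with \<open>m l \<noteq> 0\<close> contribute to mode l, and lowering that
  entry maps them bijectively onto \<open>occ d n\<close>; the factor sqrt(m l) becomes sqrt(1 + j
  l).\<close>

lemma create_annihilate_adjoint:
  "cinner_on (occ d (Suc n)) f (create d v g) = cinner_on (occ d n) (annihilate d v f) g"
proof -
  have "cinner_on (occ d (Suc n)) f (create d v g) =
     (\<Sum>l<d. \<Sum>m\<in>occ d (Suc n). cnj (f m) * (v l * sqrt (real (m l)) * g (m(l := m l - 1))))"
    unfolding cinner_on_def create_def sum_distrib_left by (rule sum.swap)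
  also have "\<dots> = (\<Sum>l<d. \<Sum>j\<in>occ d n. v l * sqrt (1 + real (j l)) * cnj (f (j(l := j l + 1))) * g j)"
  proof (rule sum.cong[OF refl])
    fix l assume "l \<in> {..<d}"
    then have l: "l < d" by simp
    have "(\<Sum>m\<in>occ d (Suc n). cnj (f m) * (v l * sqrt (real (m l)) * g (m(l := m l - 1)))) =
      (\<Sum>m\<in>{m \<in> occ d (Suc n). m l \<noteq> 0}. cnj (f m) * (v l * sqrt (real (m l)) * g (m(l := m l - 1))))"
      by (rule sum.mono_neutral_right) auto
    also have "\<dots> = (\<Sum>j\<in>occ d n. v l * sqrt (1 + real (j l)) * cnj (f (j(l := j l + 1))) * g j)"
      by (rule sum.reindex_bij_witness[where i = "\<lambda>j. j(l := j l + 1)" and j = "\<lambda>m. m(l := m l - 1)"])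
        (use l occ_raise occ_lower in \<open>auto simp: mult_ac of_nat_diff\<close>)
    finally show "(\<Sum>m\<in>occ d (Suc n). cnj (f m) * (v l * sqrt (real (m l)) * g (m(l := m l - 1)))) =
      (\<Sum>j\<in>occ d n. v l * sqrt (1 + real (j l)) * cnj (f (j(l := j l + 1))) * g j)" .
  qed
  also have "\<dots> = cinner_on (occ d n) (annihilate d v f) g"
    unfolding cinner_on_def annihilate_def cnj_sum sum_distrib_right by (subst sum.swap) simp
  finally show ?thesis .
qed

lemma cinner_on_commute: "cinner_on I f g = cnj (cinner_on I g f)"
  by (simp add: cinner_on_def mult.commute)

lemma cinner_on_cong:
  assumes "\<And>j. j \<in> I \<Longrightarrow> f j = f' j" "\<And>j. j \<in> I \<Longrightarrow> g j = g' j"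
  shows "cinner_on I f g = cinner_on I f' g'"
  using assms by (simp add: cinner_on_def)

lemma cinner_on_sum_right:
  "cinner_on I f (\<lambda>j. \<Sum>i\<in>A. c i * g i j) = (\<Sum>i\<in>A. c i * cinner_on I f (g i))"
  unfolding cinner_on_def sum_distrib_left by (subst sum.swap) (simp add: mult_ac)

lemma cinner_on_scale: "cinner_on I (\<lambda>j. a * f j) (\<lambda>j. b * g j) = cnj a * b * cinner_on I f g"
  by (simp add: cinner_on_def sum_distrib_left mult_ac)

section \<open>Number states of an arbitrary orthonormal family of modes\<close>

definition orthonormal_on :: "'a set \<Rightarrow> 'b set \<Rightarrow> ('b \<Rightarrow> 'a \<Rightarrow> complex) \<Rightarrow> bool" where
  "orthonormal_on I A v \<longleftrightarrow> (\<forall>a\<in>A. \<forall>b\<in>A. cinner_on I (v a) (v b) = (if a = b then 1 else 0))"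

text \<open>The occupation number states of the modes v 0, ..., v (d - 1). Averaging over the mode that is
created last makes the definition independent of an ordering of the modes.\<close>

fun fock :: "nat \<Rightarrow> (nat \<Rightarrow> nat \<Rightarrow> complex) \<Rightarrow> nat \<Rightarrow> (nat \<Rightarrow> nat) \<Rightarrow> (nat \<Rightarrow> nat) \<Rightarrow> complex" where
  "fock d v 0 m j = (if j = (\<lambda>_. 0) then 1 else 0)"
| "fock d v (Suc n) m j =
     (\<Sum>i<d. of_real (sqrt (real (m i)) / real (Suc n)) * create d (v i) (fock d v n (m(i := m i - 1))) j)"

text \<open>Two annihilations commute on number states. This is the statement for the amplitudes;
  \<open>lower_commute\<close> is the one for the labels.\<close>

lemma sqrt_lower_commute:
  fixes m :: "nat \<Rightarrow> nat"
  shows "sqrt (real (m i)) * sqrt (real ((m(i := m i - 1)) l)) =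
    sqrt (real (m l)) * sqrt (real ((m(l := m l - 1)) i))"
  by (cases "i = l") auto

lemma lower_commute:
  fixes m :: "nat \<Rightarrow> nat"
  shows "(m(i := m i - 1))(l := (m(i := m i - 1)) l - 1) = (m(l := m l - 1))(i := (m(l := m l - 1)) i - 1)"
  by (auto simp: fun_eq_iff)

lemma annihilate_fock_0 [simp]: "annihilate d u (fock d v 0 m) j = 0"
proof -
  have "j(l := Suc (j l)) \<noteq> (\<lambda>_. 0)" for l
    by (metis fun_upd_same nat.distinct(1))
  then show ?thesis by (simp add: annihilate_def)
qed

text \<open>The defining property of number states. Commuting a(v l) past the created mode leaves
  one term with weight 1/(n+2) from the commutator, and the induction hypothesis supplies the rest
  with weight (n+1)/(n+2).\<close>

lemma annihilate_fock_Suc: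
  assumes "orthonormal_on {..<d} {..<d} v" "l < d"
  shows "annihilate d (v l) (fock d v (Suc n) m) j = sqrt (real (m l)) * fock d v n (m(l := m l - 1)) j"
proof (induction n arbitrary: m j)
  case 0
  have z: "create d u (annihilate d u' (fock d v 0 k)) j = 0" for u u' k
    by (simp add: create_def)
  have "annihilate d (v l) (fock d v (Suc 0) m) j
    = annihilate d (v l) (\<lambda>j. \<Sum>i<d. of_real (sqrt (real (m i))) * create d (v i) (fock d v 0 (m(i := m i - 1))) j) j"
    by (intro arg_cong[where f = "\<lambda>f. annihilate d (v l) f j"] ext) simp
  also have "\<dots> = (\<Sum>i<d. sqrt (real (m i)) * (if l = i then fock d v 0 (m(i := m i - 1)) j else 0))"
    unfolding annihilate_sum canonical_commutation z
    using assms by (intro sum.cong refl) (auto simp: orthonormal_on_def)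
  also have "\<dots> = (\<Sum>i<d. if l = i then sqrt (real (m i)) * fock d v 0 (m(i := m i - 1)) j else 0)"
    by (intro sum.cong) auto
  also have "\<dots> = sqrt (real (m l)) * fock d v 0 (m(l := m l - 1)) j"
    using assms(2) by (simp only: sum.delta' finite_lessThan lessThan_iff if_True)
  finally show ?case .
next
  case (Suc n)
  let ?N = "real (Suc (Suc n))"
  have an: "annihilate d (v l) (fock d v (Suc n) k) = (\<lambda>j. sqrt (real (k l)) * fock d v n (k(l := k l - 1)) j)" for k
    using Suc.IH by (intro ext)
  have "annihilate d (v l) (fock d v (Suc (Suc n)) m) j
    = annihilate d (v l) (\<lambda>j. \<Sum>i<d. of_real (sqrt (real (m i)) / ?N) * create d (v i) (fock d v (Suc n) (m(i := m i - 1))) j) j"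
    by (intro arg_cong[where f = "\<lambda>f. annihilate d (v l) f j"] ext) (rule fock.simps)
  also have "\<dots> = (\<Sum>i<d. of_real (sqrt (real (m i)) / ?N) *
      (of_real (sqrt (real ((m(i := m i - 1)) l))) * create d (v i) (fock d v n ((m(i := m i - 1))(l := (m(i := m i - 1)) l - 1))) j
       + (if l = i then 1 else 0) * fock d v (Suc n) (m(i := m i - 1)) j))"
    unfolding annihilate_sum canonical_commutation an create_scale
    using assms by (intro sum.cong refl) (auto simp: orthonormal_on_def)
  also have "\<dots> = (\<Sum>i<d. of_real (sqrt (real (m i)) * sqrt (real ((m(i := m i - 1)) l)) / ?N)
          * create d (v i) (fock d v n ((m(l := m l - 1))(i := (m(l := m l - 1)) i - 1))) j)
       + (\<Sum>i<d. if l = i then of_real (sqrt (real (m i)) / ?N) * fock d v (Suc n) (m(i := m i - 1)) j else 0)"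
    unfolding sum.distrib[symmetric] lower_commute[of m _ l]
    by (intro sum.cong refl) (simp add: algebra_simps)
  also have "(\<Sum>i<d. if l = i then of_real (sqrt (real (m i)) / ?N) * fock d v (Suc n) (m(i := m i - 1)) j else 0)
      = of_real (sqrt (real (m l)) / ?N) * fock d v (Suc n) (m(l := m l - 1)) j"
    using assms by simp
  \<comment> \<open>With the two lowerings exchanged, the sum is the averaged definition of
    \<open>fock\<close> at level \<open>Suc n\<close> for m lowered in l, up to the factor
    \<open>Suc n / ?N\<close>, which replaces the normalization of that level.\<close>
  also have "(\<Sum>i<d. of_real (sqrt (real (m i)) * sqrt (real ((m(i := m i - 1)) l)) / ?N)
          * create d (v i) (fock d v n ((m(l := m l - 1))(i := (m(l := m l - 1)) i - 1))) j)
      = of_real (sqrt (real (m l)) * real (Suc n) / ?N) * fock d v (Suc n) (m(l := m l - 1)) j"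
    unfolding sqrt_lower_commute[of m _ l] fock.simps sum_distrib_left
    by (intro sum.cong refl) (simp add: field_simps del: of_nat_Suc)
  also have "\<dots> + of_real (sqrt (real (m l)) / ?N) * fock d v (Suc n) (m(l := m l - 1)) j
      = of_real (sqrt (real (m l)) * real (Suc n) / ?N + sqrt (real (m l)) / ?N) * fock d v (Suc n) (m(l := m l - 1)) j"
    by (simp add: algebra_simps)
  also have "sqrt (real (m l)) * real (Suc n) / ?N + sqrt (real (m l)) / ?N = sqrt (real (m l))"
    by (simp add: add_divide_distrib[symmetric] nonzero_divide_eq_eq algebra_simps)
  finally show ?case .
qed

lemma lower_eq_iff:
  fixes m m' :: "nat \<Rightarrow> nat"
  assumes "m i \<noteq> 0" "m' i \<noteq> 0"
  shows "m(i := m i - 1) = m'(i := m' i - 1) \<longleftrightarrow> m = m'"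
proof
  assume eq: "m(i := m i - 1) = m'(i := m' i - 1)"
  have "m x = m' x" for x
    using fun_cong[OF eq, of x] assms by (cases "x = i") auto
  then show "m = m'" ..
qed simp

text \<open>These are the matrix elements of the number operator of mode i, since sqrt(m i) times
  the lowered state is a(v i) applied to the state m. If \<open>m i\<close> or \<open>m' i\<close>
  is 0, the lowering is spurious, but the coefficient vanishes.\<close>

lemma lowered_fock_inner:
  assumes "orthonormal_on (occ d n) (occ d n) (fock d v n)"
    and "m \<in> occ d (Suc n)" "m' \<in> occ d (Suc n)" "i < d"
  shows "of_real (sqrt (real (m i)) * sqrt (real (m' i)))
      * cinner_on (occ d n) (fock d v n (m(i := m i - 1))) (fock d v n (m'(i := m' i - 1)))
    = (if m = m' then of_nat (m i) else 0)"
proof (cases "m i = 0 \<or> m' i = 0")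
  case False
  then have "cinner_on (occ d n) (fock d v n (m(i := m i - 1))) (fock d v n (m'(i := m' i - 1))) = (if m = m' then 1 else 0)"
    using assms occ_lower lower_eq_iff[of m i m'] unfolding orthonormal_on_def by simp
  then show ?thesis by (simp flip: of_real_mult)
qed auto

text \<open>Each creation operator in the right factor becomes an annihilation operator on the left
  one. Number operators remain, and their eigenvalues m i add up to n+1, which cancels the averaging
  factor in \<open>fock\<close>.\<close>

lemma orthonormal_fock:
  assumes v: "orthonormal_on {..<d} {..<d} v"
  shows "orthonormal_on (occ d n) (occ d n) (fock d v n)"
proof (induction n)
  case 0
  show ?case by (simp add: occ_eq_0 orthonormal_on_def cinner_on_def)
next
  case (Suc n)
  show ?case unfolding orthonormal_on_def
  proof (intro ballI)
    fix m m' assume m: "m \<in> occ d (Suc n)" and m': "m' \<in> occ d (Suc n)"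
    have "cinner_on (occ d (Suc n)) (fock d v (Suc n) m) (fock d v (Suc n) m')
      = cinner_on (occ d (Suc n)) (fock d v (Suc n) m) (\<lambda>j. \<Sum>i<d. of_real (sqrt (real (m' i)) / real (Suc n)) * create d (v i) (fock d v n (m'(i := m' i - 1))) j)"
      by (rule cinner_on_cong) simp_all
    also have "\<dots> = (\<Sum>i<d. of_real (sqrt (real (m' i)) / real (Suc n)) * cinner_on (occ d n)
        (\<lambda>j. of_real (sqrt (real (m i))) * fock d v n (m(i := m i - 1)) j) (\<lambda>j. 1 * fock d v n (m'(i := m' i - 1)) j))"
      unfolding cinner_on_sum_right create_annihilate_adjoint
      by (intro sum.cong refl arg_cong2[where f = "(*)"] cinner_on_cong)
         (simp_all add: annihilate_fock_Suc[OF v] del: fock.simps)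
    also have "\<dots> = (\<Sum>i<d. of_real (1 / real (Suc n)) * (of_real (sqrt (real (m i)) * sqrt (real (m' i)))
      * cinner_on (occ d n) (fock d v n (m(i := m i - 1))) (fock d v n (m'(i := m' i - 1)))))"
      unfolding cinner_on_scale by (intro sum.cong refl) simp
    also have "\<dots> = (\<Sum>i<d. of_real (1 / real (Suc n)) * (if m = m' then of_nat (m i) else 0))"
      using lowered_fock_inner[OF Suc m m'] by (intro sum.cong refl arg_cong2[where f = "(*)"]) auto
    also have "\<dots> = (if m = m' then of_real (1 / real (Suc n)) * of_nat (\<Sum>i<d. m i) else 0)"
      by (simp add: sum_distrib_left del: of_nat_Suc)
    also have "\<dots> = (if m = m' then 1 else 0)"
      using m by (auto simp: occ_def simp del: of_nat_Suc of_nat_sum)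
    finally show "cinner_on (occ d (Suc n)) (fock d v (Suc n) m) (fock d v (Suc n) m') = (if m = m' then 1 else 0)" .
  qed
qed

subsection \<open>Entropies and spectral decomposition\<close>

lemma proots_prod_linear: "proots (\<Prod>a\<leftarrow>as. [:- a, 1:]) = mset (as :: 'a :: idom list)"
proof (induction as)
  case (Cons a as)
  have "(\<Prod>a\<leftarrow>as. [:- a, 1:]) \<noteq> (0 :: 'a poly)"
    by (auto simp: prod_list_zero_iff)
  then show ?case using Cons by (simp add: proots_mult del: mult_pCons_left)
qed simp

text \<open>Passing to the basis \<open>w\<close> is a similarity of matrices, so the characteristic
  polynomial is that of the diagonal matrix of the \<open>t a\<close>; the chosen enumeration of
  \<open>I\<close> drops out. The basis is labelled by \<open>I\<close> itself, which makes it
  complete.\<close>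

lemma vN_entropy_diagonalized:
  assumes fin: "finite I" and w: "orthonormal_on I I w"
    and diag: "\<And>a b. a \<in> I \<Longrightarrow> b \<in> I \<Longrightarrow>
      (\<Sum>i\<in>I. \<Sum>j\<in>I. cnj (w a i) * rho i j * w b j) = (if a = b then of_real (t a) else 0)"
  shows "vN_entropy I rho = - (\<Sum>a\<in>I. entr (t a))"
proof -
  define xs where "xs = enum_set I"
  have "\<exists>xs. distinct xs \<and> set xs = I"
    using finite_distinct_list[OF fin] by blast
  then have xs: "distinct xs" "set xs = I"
    unfolding xs_def enum_set_def by (metis (mono_tags, lifting) someI_ex)+
  define N where "N = length xs"
  have bij: "bij_betw (\<lambda>i. xs ! i) {0..<N} I"
    using bij_betw_nth[OF xs(1), of "{0..<N}" I] xs(2) by (simp add: N_def lessThan_atLeast0)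
  have sumI: "(\<Sum>i = 0..<N. f (xs ! i)) = sum f I" for f :: "'a \<Rightarrow> 'b :: comm_monoid_add"
    using sum.reindex_bij_betw[OF bij] .
  have inI: "xs ! i \<in> I" if "i < N" for i using that xs(2) by (auto simp: N_def)
  have nth_eq: "xs ! i = xs ! j \<longleftrightarrow> i = j" if "i < N" "j < N" for i j
    using that xs(1) by (simp add: N_def nth_eq_iff_index_eq)
  define U where "U = mat N N (\<lambda>(i, j). w (xs ! j) (xs ! i))"
  define V where "V = mat N N (\<lambda>(i, j). cnj (w (xs ! i) (xs ! j)))"
  define D where "D = mat N N (\<lambda>(i, j). if i = j then complex_of_real (t (xs ! i)) else 0)"
  define M where "M = mat_on I rho"
  have M: "M = mat N N (\<lambda>(i, j). rho (xs ! i) (xs ! j))"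
    unfolding M_def mat_on_def N_def xs_def Let_def ..
  have carr: "U \<in> carrier_mat N N" "V \<in> carrier_mat N N" "D \<in> carrier_mat N N" "M \<in> carrier_mat N N"
    by (simp_all add: U_def V_def D_def M)
  have VU: "V * U = 1\<^sub>m N"
  proof (rule eq_matI)
    fix i j assume "i < dim_row (1\<^sub>m N :: complex mat)" "j < dim_col (1\<^sub>m N :: complex mat)"
    then have ij: "i < N" "j < N" by simp_all
    have "(V * U) $$ (i, j) = cinner_on I (w (xs ! i)) (w (xs ! j))"
      using ij sumI[of "\<lambda>k. cnj (w (xs ! i) k) * w (xs ! j) k"]
      by (simp add: U_def V_def scalar_prod_def cinner_on_def)
    then show "(V * U) $$ (i, j) = 1\<^sub>m N $$ (i, j)"
      using ij w inI nth_eq by (simp add: orthonormal_on_def)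
  qed (simp_all add: U_def V_def)
  have UV: "U * V = 1\<^sub>m N"
    using mat_mult_left_right_inverse[OF carr(2,1) VU] .
  have VMU: "V * M * U = D"
  proof (rule eq_matI)
    fix i j assume "i < dim_row D" "j < dim_col D"
    then have ij: "i < N" "j < N" by (simp_all add: D_def)
    have "(V * M * U) $$ (i, j) =
        (\<Sum>l = 0..<N. (\<Sum>k = 0..<N. cnj (w (xs ! i) (xs ! k)) * rho (xs ! k) (xs ! l)) * w (xs ! j) (xs ! l))"
      using ij by (simp add: U_def V_def M scalar_prod_def)
    also have "\<dots> = (\<Sum>l\<in>I. (\<Sum>k\<in>I. cnj (w (xs ! i) k) * rho k l) * w (xs ! j) l)"
      by (simp only: sumI[of "\<lambda>k. cnj (w (xs ! i) k) * rho k (xs ! l)" for l] 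
        sumI[of "\<lambda>l. (\<Sum>k\<in>I. cnj (w (xs ! i) k) * rho k l) * w (xs ! j) l"])
    also have "\<dots> = (\<Sum>k\<in>I. \<Sum>l\<in>I. cnj (w (xs ! i) k) * rho k l * w (xs ! j) l)"
      unfolding sum_distrib_right by (rule sum.swap)
    also have "\<dots> = D $$ (i, j)"
      using ij inI nth_eq by (simp add: diag D_def)
    finally show "(V * M * U) $$ (i, j) = D $$ (i, j)" .
  qed (simp_all add: U_def V_def D_def)
  have "U * D * V = (U * V) * M * (U * V)"
    unfolding VMU[symmetric] using carr by (simp add: assoc_mult_mat[of _ N N _ N _ N])
  then have "M = U * D * V" using UV carr by simp
  then have "similar_mat M D"
    using carr UV VU by (intro similar_matI[of _ _ U V N]) auto
  then have "char_poly M = char_poly D" by (rule char_poly_similar)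
  also have "\<dots> = (\<Prod>a\<leftarrow>diag_mat D. [:- a, 1:])"
    by (rule char_poly_upper_triangular[OF carr(3)]) (simp add: upper_triangular_def D_def)
  finally have "proots (char_poly M) = mset (diag_mat D)"
    by (simp add: proots_prod_linear)
  moreover have "diag_mat D = map (\<lambda>i. complex_of_real (t (xs ! i))) [0..<N]"
    unfolding diag_mat_def by (rule map_cong) (auto simp: D_def)
  ultimately have "(\<Sum>l\<in>#proots (char_poly M). entr (Re l)) = (\<Sum>i\<leftarrow>[0..<N]. entr (t (xs ! i)))"
    by (simp flip: mset_map sum_mset_sum_list add: comp_def)
  also have "\<dots> = (\<Sum>a\<in>I. entr (t a))"
    by (simp add: sumI[of "\<lambda>a. entr (t a)"] interv_sum_list_conv_sum_set_nat)
  finally show ?thesis by (simp add: vN_entropy_def M_def)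
qed

section \<open>Spectral theorem for Hermitian matrices and density matrices\<close>

lemma orthonormal_complete:
  fixes d :: nat
  assumes v: "orthonormal_on {..<d} {..<d} v" and ab: "a < d" "b < d"
  shows "(\<Sum>i<d. v i a * cnj (v i b)) = (if a = b then 1 else 0)"
proof -
  define U where "U = mat d d (\<lambda>(i, j). v j i)"
  define V where "V = mat d d (\<lambda>(i, j). cnj (v i j))"
  have carr: "U \<in> carrier_mat d d" "V \<in> carrier_mat d d" by (simp_all add: U_def V_def)
  have "V * U = 1\<^sub>m d"
    using v by (intro eq_matI) (auto simp: U_def V_def scalar_prod_def orthonormal_on_def cinner_on_def lessThan_atLeast0)
  then have "U * V = 1\<^sub>m d"
    by (rule mat_mult_left_right_inverse[OF carr(2,1)])
  then have "(U * V) $$ (a, b) = 1\<^sub>m d $$ (a, b)" by simp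
  then show ?thesis
    using ab by (simp add: U_def V_def scalar_prod_def lessThan_atLeast0)
qed

text \<open>The trace is the sum of the diagonal of a Schur form, which lists the eigenvalues. If
  all of them were \<open>s\<close>, the trace would be d times s.\<close>

lemma eigenvector_avoiding:
  fixes rho :: "nat \<Rightarrow> nat \<Rightarrow> complex"
  assumes tr: "(\<Sum>a<d. rho a a) \<noteq> of_nat d * s"
  shows "\<exists>\<mu> w. \<mu> \<noteq> s \<and> (\<exists>a<d. w a \<noteq> 0) \<and> (\<forall>a<d. (\<Sum>b<d. rho a b * w b) = \<mu> * w a)"
proof -
  define A where "A = mat d d (\<lambda>(i, j). rho i j)"
  have A: "A \<in> carrier_mat d d" by (simp add: A_def)
  obtain es where es: "char_poly A = (\<Prod>a\<leftarrow>es. [:- a, 1:])" "length es = d"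
    using char_poly_factorized[OF A] by blast
  obtain B P Q where schur: "schur_decomposition A es = (B, P, Q)"
    by (cases "schur_decomposition A es")
  have wit: "similar_mat_wit A B P Q" and diagB: "diag_mat B = es"
    using schur_decomposition[OF A es(1) schur] by auto
  have carr: "B \<in> carrier_mat d d" "P \<in> carrier_mat d d" "Q \<in> carrier_mat d d"
    and QP: "Q * P = 1\<^sub>m d" and APBQ: "A = P * B * Q"
    using similar_mat_witD2[OF A wit] by auto
  have tr_comm: "(\<Sum>i<d. (X * Y) $$ (i, i)) = (\<Sum>i<d. (Y * X) $$ (i, i))"
    if "X \<in> carrier_mat d d" "Y \<in> carrier_mat d d" for X Y :: "complex mat"
  proof -
    have "(\<Sum>i<d. (X * Y) $$ (i, i)) = (\<Sum>i<d. \<Sum>j<d. X $$ (i, j) * Y $$ (j, i))"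
      using that by (simp add: scalar_prod_def lessThan_atLeast0)
    also have "\<dots> = (\<Sum>i<d. \<Sum>j<d. Y $$ (i, j) * X $$ (j, i))"
      by (subst sum.swap) (simp add: mult.commute)
    also have "\<dots> = (\<Sum>i<d. (Y * X) $$ (i, i))"
      using that by (simp add: scalar_prod_def lessThan_atLeast0)
    finally show ?thesis .
  qed
  have "(\<Sum>a<d. rho a a) = (\<Sum>i<d. (P * B * Q) $$ (i, i))"
    unfolding APBQ[symmetric] by (simp add: A_def)
  also have "\<dots> = (\<Sum>i<d. (Q * (P * B)) $$ (i, i))"
    using carr by (intro tr_comm) auto
  also have "Q * (P * B) = B"
    using carr QP by (simp flip: assoc_mult_mat[of Q d d P d B d])
  also have "(\<Sum>i<d. B $$ (i, i)) = sum_list es"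
    using carr unfolding diagB[symmetric] diag_mat_def
    by (simp add: interv_sum_list_conv_sum_set_nat lessThan_atLeast0)
  finally have "sum_list es \<noteq> of_nat d * s" using tr by simp
  moreover have "sum_list es = of_nat (length es) * s" if "\<forall>e\<in>set es. e = s"
    using that by (induction es) (auto simp: algebra_simps)
  ultimately obtain \<mu> where \<mu>: "\<mu> \<in> set es" "\<mu> \<noteq> s" using es(2) by blast
  then have "poly (char_poly A) \<mu> = 0"
    by (auto simp: es(1) poly_prod_list prod_list_zero_iff)
  then have "eigenvalue A \<mu>"
    by (simp add: eigenvalue_root_char_poly[OF A])
  then obtain u where u: "u \<in> carrier_vec d" "u \<noteq> 0\<^sub>v d" "A *\<^sub>v u = \<mu> \<cdot>\<^sub>v u"
    using A by (auto simp: eigenvalue_def eigenvector_def)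
  show ?thesis
  proof (rule exI[of _ \<mu>], rule exI[of _ "\<lambda>a. u $ a"], intro conjI allI impI)
    show "\<mu> \<noteq> s" by (fact \<mu>(2))
    show "\<exists>a<d. u $ a \<noteq> 0"
      using u(1,2) by (metis carrier_vecD eq_vecI index_zero_vec)
    fix a assume a: "a < d"
    have "(A *\<^sub>v u) $ a = (\<mu> \<cdot>\<^sub>v u) $ a" using u(3) by simp
    then show "(\<Sum>b<d. rho a b * u $ b) = \<mu> * u $ a"
      using a u(1) by (simp add: A_def scalar_prod_def lessThan_atLeast0)
  qed
qed

lemma orthonormal_extend:
  fixes rho :: "nat \<Rightarrow> nat \<Rightarrow> complex"
  assumes herm: "\<And>a b. a < d \<Longrightarrow> b < d \<Longrightarrow> rho b a = cnj (rho a b)"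
    and n: "n < d" and v: "orthonormal_on {..<d} {..<n} v"
    and eig: "\<And>i a. i < n \<Longrightarrow> a < d \<Longrightarrow> (\<Sum>b<d. rho a b * v i b) = of_real (q i) * v i a"
  shows "\<exists>u r. cinner_on {..<d} u u = 1 \<and> (\<forall>i<n. cinner_on {..<d} (v i) u = 0) \<and>
    (\<forall>a<d. (\<Sum>b<d. rho a b * u b) = of_real r * u a)"
proof -
  let ?ip = "cinner_on {..<d}"
  \<comment> \<open>Deflation: sig moves all the eigenvectors v i to the single eigenvalue s, which is chosen such that
    s alone cannot account for the trace. An eigenvector for another eigenvalue of sig
    is then automatically orthogonal to every v i.\<close>
  define T where "T = (\<Sum>a<d. rho a a) - (\<Sum>i<n. complex_of_real (q i))"
  \<comment> \<open>The deflated matrix has trace T + n s, and this must differ from d s. As n < d,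
    the value 1 works when T vanishes and 0 works otherwise.\<close>
  define s where "s = (if T = 0 then 1 else 0 :: complex)"
  define sig where "sig a b = rho a b + (\<Sum>i<n. (s - of_real (q i)) * v i a * cnj (v i b))" for a b
  have ipv: "?ip (v i) (v j) = (if i = j then 1 else 0)" if "i < n" "j < n" for i j
    using v that by (simp add: orthonormal_on_def)
  have "(\<Sum>a<d. sig a a) = (\<Sum>a<d. rho a a) + (\<Sum>i<n. (s - of_real (q i)) * ?ip (v i) (v i))"
    unfolding sig_def sum.distrib cinner_on_def sum_distrib_left
    by (subst (2) sum.swap) (simp add: mult_ac)
  also have "\<dots> = T + of_nat n * s"
    by (simp add: ipv T_def sum_subtractf)
  finally have "(\<Sum>a<d. sig a a) = T + of_nat n * s" .
  moreover have "T + of_nat n * s \<noteq> of_nat d * s"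
    using n by (simp add: s_def)
  ultimately have "(\<Sum>a<d. sig a a) \<noteq> of_nat d * s" by simp
  then obtain \<mu> w where \<mu>: "\<mu> \<noteq> s" and w0: "\<exists>a<d. w a \<noteq> 0"
    and "\<forall>a<d. (\<Sum>b<d. sig a b * w b) = \<mu> * w a"
    using eigenvector_avoiding[where rho = sig] by blast
  then have w: "(\<Sum>b<d. sig a b * w b) = \<mu> * w a" if "a < d" for a using that by blast
  have orth: "?ip (v i) w = 0" if i: "i < n" for i
  proof -
    \<comment> \<open>Hermiticity makes \<open>v i\<close> also a left eigenvector of
      \<open>sig\<close> with eigenvalue \<open>s\<close>. Pairing it with the right eigenvector
      \<open>w\<close> of eigenvalue \<mu> \<noteq> s forces orthogonality.\<close>
    have left: "(\<Sum>a<d. cnj (v i a) * sig a b) = s * cnj (v i b)" if b: "b < d" for b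
    proof -
      have "(\<Sum>a<d. cnj (v i a) * rho a b) = cnj (\<Sum>a<d. rho b a * v i a)"
        unfolding cnj_sum using b by (intro sum.cong refl) (simp add: herm[of _ b] mult.commute)
      also have "\<dots> = of_real (q i) * cnj (v i b)" using eig[OF i b] by simp
      finally have 1: "(\<Sum>a<d. cnj (v i a) * rho a b) = of_real (q i) * cnj (v i b)" .
      have "(\<Sum>a<d. cnj (v i a) * (\<Sum>j<n. (s - of_real (q j)) * v j a * cnj (v j b)))
          = (\<Sum>j<n. (s - of_real (q j)) * cnj (v j b) * ?ip (v i) (v j))"
        unfolding sum_distrib_left cinner_on_def by (subst sum.swap) (simp add: mult_ac)
      also have "\<dots> = (\<Sum>j<n. if i = j then (s - of_real (q j)) * cnj (v j b) else 0)"
        using i by (intro sum.cong refl) (simp add: ipv)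
      also have "\<dots> = (s - of_real (q i)) * cnj (v i b)" using i by simp
      finally show ?thesis
        unfolding sig_def distrib_left sum.distrib 1 by (simp add: algebra_simps)
    qed
    have "\<mu> * ?ip (v i) w = (\<Sum>a<d. cnj (v i a) * (\<mu> * w a))"
      by (simp add: cinner_on_def sum_distrib_left mult_ac)
    also have "\<dots> = (\<Sum>a<d. cnj (v i a) * (\<Sum>b<d. sig a b * w b))"
      by (intro sum.cong refl) (simp only: w lessThan_iff)
    also have "\<dots> = (\<Sum>b<d. (\<Sum>a<d. cnj (v i a) * sig a b) * w b)"
      unfolding sum_distrib_left sum_distrib_right by (subst sum.swap) (simp add: mult_ac)
    also have "\<dots> = (\<Sum>b<d. s * cnj (v i b) * w b)"
      by (intro sum.cong refl) (simp only: left lessThan_iff)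
    also have "\<dots> = s * ?ip (v i) w"
      by (simp add: cinner_on_def sum_distrib_left mult_ac)
    finally show ?thesis using \<mu> by simp
  qed
  \<comment> \<open>On vectors orthogonal to all \<open>v i\<close> the rank-one corrections vanish,
    so \<open>sig\<close> and \<open>rho\<close> agree on \<open>w\<close>.\<close>
  have eigw: "(\<Sum>b<d. rho a b * w b) = \<mu> * w a" if a: "a < d" for a
  proof -
    have "(\<Sum>b<d. sig a b * w b) = (\<Sum>b<d. rho a b * w b) + (\<Sum>i<n. (s - of_real (q i)) * v i a * ?ip (v i) w)"
      unfolding sig_def distrib_right sum.distrib cinner_on_def sum_distrib_left sum_distrib_right
      by (subst (2) sum.swap) (simp add: mult_ac)
    then show ?thesis using w[OF a] orth by simp
  qed
  define N where "N = (\<Sum>a<d. (cmod (w a))\<^sup>2)"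
  have ww: "?ip w w = of_real N"
    unfolding cinner_on_def N_def of_real_sum
    by (intro sum.cong refl) (simp add: mult.commute complex_norm_square del: of_real_power)
  have Npos: "N > 0"
    unfolding N_def using w0 by (auto intro!: sum_pos2)
  \<comment> \<open>The quadratic form of a Hermitian matrix is real, and so is <w,w> > 0; hence
    \<mu> is real.\<close>
  have quad: "\<mu> * ?ip w w = (\<Sum>a<d. \<Sum>b<d. cnj (w a) * rho a b * w b)"
  proof -
    have "\<mu> * ?ip w w = (\<Sum>a<d. cnj (w a) * (\<mu> * w a))"
      by (simp add: cinner_on_def sum_distrib_left mult_ac)
    also have "\<dots> = (\<Sum>a<d. cnj (w a) * (\<Sum>b<d. rho a b * w b))"
      by (intro sum.cong refl) (simp only: eigw lessThan_iff)
    finally show ?thesis by (simp add: sum_distrib_left mult_ac)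
  qed
  have "cnj (\<mu> * ?ip w w) = (\<Sum>a<d. \<Sum>b<d. cnj (w b) * rho b a * w a)"
    unfolding quad cnj_sum by (intro sum.cong refl) (simp add: herm[symmetric] mult_ac)
  also have "\<dots> = \<mu> * ?ip w w" unfolding quad by (rule sum.swap)
  finally have "cnj \<mu> = \<mu>" using Npos by (simp add: ww)
  then have \<mu>r: "\<mu> = of_real (Re \<mu>)"
    by (simp add: complex_eq_iff)
  define c where "c = complex_of_real (1 / sqrt N)"
  show ?thesis
  proof (rule exI[of _ "\<lambda>a. c * w a"], rule exI[of _ "Re \<mu>"], intro conjI allI impI)
    have "cnj c * c = of_real (1 / N)"
      using Npos unfolding c_def by (simp flip: of_real_mult)
    then show "?ip (\<lambda>a. c * w a) (\<lambda>a. c * w a) = 1"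
      using Npos by (simp add: cinner_on_scale ww)
    show "?ip (v i) (\<lambda>a. c * w a) = 0" if "i < n" for i
      using cinner_on_scale[of "{..<d}" 1 "v i" c w] orth[OF that] by simp
    show "(\<Sum>b<d. rho a b * (c * w b)) = of_real (Re \<mu>) * (c * w a)" if "a < d" for a
    proof -
      have "(\<Sum>b<d. rho a b * (c * w b)) = c * (\<Sum>b<d. rho a b * w b)"
        by (simp add: sum_distrib_left mult_ac)
      then show ?thesis using eigw[OF that] \<mu>r by (simp add: mult_ac)
    qed
  qed
qed

lemma orthonormal_eigenvectors:
  fixes rho :: "nat \<Rightarrow> nat \<Rightarrow> complex"
  assumes herm: "\<And>a b. a < d \<Longrightarrow> b < d \<Longrightarrow> rho b a = cnj (rho a b)" and "n \<le> d"
  shows "\<exists>v q. orthonormal_on {..<d} {..<n} v \<and>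
    (\<forall>i<n. \<forall>a<d. (\<Sum>b<d. rho a b * v i b) = of_real (q i) * v i a)"
  using assms(2)
proof (induction n)
  case 0
  show ?case by (simp add: orthonormal_on_def)
next
  case (Suc n)
  then obtain v q where v: "orthonormal_on {..<d} {..<n} v"
    and eig: "\<And>i a. i < n \<Longrightarrow> a < d \<Longrightarrow> (\<Sum>b<d. rho a b * v i b) = of_real (q i) * v i a"
    by auto
  from Suc.prems have n: "n < d" by simp
  obtain u r where u: "cinner_on {..<d} u u = 1" "\<forall>i<n. cinner_on {..<d} (v i) u = 0"
    "\<forall>a<d. (\<Sum>b<d. rho a b * u b) = of_real r * u a"
    using orthonormal_extend[where rho = rho and v = v and q = q and n = n, OF herm n v eig] by blast
  have u2: "cinner_on {..<d} u (v i) = 0" if "i < n" for i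
    using u(2) that cinner_on_commute[of "{..<d}" u "v i"] by simp
  have "orthonormal_on {..<d} {..<Suc n} (v(n := u))"
    using v u(1,2) u2 by (auto simp: orthonormal_on_def less_Suc_eq)
  moreover have "\<forall>i<Suc n. \<forall>a<d. (\<Sum>b<d. rho a b * (v(n := u)) i b) = of_real ((q(n := r)) i) * (v(n := u)) i a"
    using eig u(3) by (auto simp: less_Suc_eq)
  ultimately show ?case by blast
qed

text \<open>Multiplying \<open>rho\<close> by the resolution of the identity of a full orthonormal
  eigenbasis turns the eigenvector equations into the expansion.\<close>

theorem hermitian_spectral_decomposition:
  fixes rho :: "nat \<Rightarrow> nat \<Rightarrow> complex"
  assumes herm: "\<And>a b. a < d \<Longrightarrow> b < d \<Longrightarrow> rho b a = cnj (rho a b)"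
  shows "\<exists>v q. orthonormal_on {..<d} {..<d} v \<and>
    (\<forall>a<d. \<forall>b<d. rho a b = (\<Sum>i<d. of_real (q i) * v i a * cnj (v i b)))"
proof -
  obtain v q where v: "orthonormal_on {..<d} {..<d} v"
    and eig: "\<And>i a. i < d \<Longrightarrow> a < d \<Longrightarrow> (\<Sum>b<d. rho a b * v i b) = of_real (q i) * v i a"
    using orthonormal_eigenvectors[where rho = rho and d = d and n = d, OF herm order_refl] by auto
  have "rho a c = (\<Sum>i<d. of_real (q i) * v i a * cnj (v i c))" if ac: "a < d" "c < d" for a c
  proof -
    have "(\<Sum>i<d. of_real (q i) * v i a * cnj (v i c)) = (\<Sum>i<d. (\<Sum>b<d. rho a b * v i b) * cnj (v i c))"
      using ac by (intro sum.cong refl) (simp add: eig)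
    also have "\<dots> = (\<Sum>b<d. rho a b * (\<Sum>i<d. v i b * cnj (v i c)))"
      unfolding sum_distrib_left sum_distrib_right by (subst sum.swap) (simp add: mult_ac)
    also have "\<dots> = (\<Sum>b<d. if b = c then rho a b else 0)"
      using ac by (intro sum.cong refl) (simp add: orthonormal_complete[OF v])
    also have "\<dots> = rho a c" using ac by simp
    finally show ?thesis by simp
  qed
  with v show ?thesis by blast
qed

text \<open>Input mixtures and both channel outputs are sums of rank-one matrices; their forms split
  into products of inner products.\<close>

lemma quadratic_form_rank_one_sum:
  "(\<Sum>a\<in>I. \<Sum>b\<in>J. cnj (u a) * (\<Sum>k\<in>K. c k * f k a * cnj (g k b)) * w b) =
    (\<Sum>k\<in>K. c k * cinner_on I u (f k) * cinner_on J (g k) w)"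
proof -
  have "(\<Sum>a\<in>I. \<Sum>b\<in>J. cnj (u a) * (\<Sum>k\<in>K. c k * f k a * cnj (g k b)) * w b)
      = (\<Sum>a\<in>I. \<Sum>k\<in>K. \<Sum>b\<in>J. c k * ((cnj (u a) * f k a) * (cnj (g k b) * w b)))"
    unfolding sum_distrib_left sum_distrib_right
    by (intro sum.cong refl, subst sum.swap) (simp add: mult_ac)
  also have "\<dots> = (\<Sum>k\<in>K. \<Sum>a\<in>I. \<Sum>b\<in>J. c k * ((cnj (u a) * f k a) * (cnj (g k b) * w b)))"
    by (rule sum.swap)
  also have "\<dots> = (\<Sum>k\<in>K. c k * cinner_on I u (f k) * cinner_on J (g k) w)"
  proof (rule sum.cong[OF refl])
    fix k
    have "c k * cinner_on I u (f k) * cinner_on J (g k) w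
        = c k * (\<Sum>a\<in>I. \<Sum>b\<in>J. (cnj (u a) * f k a) * (cnj (g k b) * w b))"
      by (simp only: cinner_on_def mult.assoc[of "c k"] sum_product)
    then show "(\<Sum>a\<in>I. \<Sum>b\<in>J. c k * ((cnj (u a) * f k a) * (cnj (g k b) * w b))) =
        c k * cinner_on I u (f k) * cinner_on J (g k) w"
      by (simp only: sum_distrib_left)
  qed
  finally show ?thesis .
qed

lemma cinner_on_mult_commute: "cinner_on I f g * cinner_on I g f = of_real ((cmod (cinner_on I f g))\<^sup>2)"
  by (subst (2) cinner_on_commute) (simp only: complex_norm_square)

text \<open>Each q i is the expectation of the mixture in \<open>v i\<close>, a sum of squared
  overlaps weighted by \<open>p\<close>, hence nonnegative. Comparing traces gives the total
  1.\<close>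

lemma density_spectral_decomposition:
  fixes p :: "'y \<Rightarrow> real" and psi :: "'y \<Rightarrow> nat \<Rightarrow> complex"
  assumes p: "\<And>y. y \<in> Y \<Longrightarrow> p y \<ge> 0" "sum p Y = 1"
    and unit: "\<And>y. y \<in> Y \<Longrightarrow> cinner_on {..<d} (psi y) (psi y) = 1"
  shows "\<exists>v q. orthonormal_on {..<d} {..<d} v \<and> (\<forall>i<d. q i \<ge> 0) \<and> (\<Sum>i<d. q i) = 1 \<and>
    (\<forall>a<d. \<forall>b<d. (\<Sum>y\<in>Y. of_real (p y) * psi y a * cnj (psi y b))
       = (\<Sum>i<d. of_real (q i) * v i a * cnj (v i b)))"
proof -
  define rho where "rho a b = (\<Sum>y\<in>Y. of_real (p y) * psi y a * cnj (psi y b))" for a b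
  have herm: "rho b a = cnj (rho a b)" for a b
    unfolding rho_def cnj_sum by (intro sum.cong refl) (simp add: mult_ac)
  obtain v q where v: "orthonormal_on {..<d} {..<d} v"
    and "\<forall>a<d. \<forall>b<d. rho a b = (\<Sum>i<d. of_real (q i) * v i a * cnj (v i b))"
    using hermitian_spectral_decomposition[of d rho, OF herm] by blast
  then have dec: "rho a b = (\<Sum>i<d. of_real (q i) * v i a * cnj (v i b))" if "a < d" "b < d" for a b
    using that by blast
  have ipv: "cinner_on {..<d} (v i) (v j) = (if i = j then 1 else 0)" if "i < d" "j < d" for i j
    using v that by (simp add: orthonormal_on_def)
  have nonneg: "q i \<ge> 0" if i: "i < d" for i
  proof -
    have "complex_of_real (q i) = (\<Sum>j<d. if i = j then of_real (q j) else 0)" using i by simp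
    also have "\<dots> = (\<Sum>j<d. of_real (q j) * cinner_on {..<d} (v i) (v j) * cinner_on {..<d} (v j) (v i))"
      using i by (intro sum.cong refl) (simp add: ipv)
    also have "\<dots> = (\<Sum>a<d. \<Sum>b<d. cnj (v i a) * rho a b * v i b)"
      unfolding quadratic_form_rank_one_sum[symmetric] by (intro sum.cong refl) (simp add: dec)
    also have "\<dots> = (\<Sum>y\<in>Y. of_real (p y) * cinner_on {..<d} (v i) (psi y) * cinner_on {..<d} (psi y) (v i))"
      unfolding rho_def by (rule quadratic_form_rank_one_sum)
    also have "\<dots> = of_real (\<Sum>y\<in>Y. p y * (cmod (cinner_on {..<d} (v i) (psi y)))\<^sup>2)"
      by (simp add: mult.assoc cinner_on_mult_commute)
    finally have "q i = (\<Sum>y\<in>Y. p y * (cmod (cinner_on {..<d} (v i) (psi y)))\<^sup>2)"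
      by (simp only: of_real_eq_iff)
    then show ?thesis using p(1) by (simp add: sum_nonneg)
  qed
  have "complex_of_real (\<Sum>i<d. q i) = (\<Sum>i<d. of_real (q i) * cinner_on {..<d} (v i) (v i))"
    by (simp add: ipv)
  also have "\<dots> = (\<Sum>a<d. rho a a)"
    unfolding cinner_on_def sum_distrib_left by (subst sum.swap) (simp add: dec mult_ac)
  also have "\<dots> = (\<Sum>y\<in>Y. of_real (p y) * cinner_on {..<d} (psi y) (psi y))"
    unfolding cinner_on_def sum_distrib_left rho_def by (subst sum.swap) (simp add: mult_ac)
  also have "\<dots> = of_real (sum p Y)" by (simp add: unit)
  finally have sum1: "(\<Sum>i<d. q i) = 1" using p(2) by (simp only: of_real_eq_iff)
  show ?thesis
    using v nonneg sum1 dec unfolding rho_def by blast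
qed

subsection \<open>Spectra of the channel outputs\<close>

text \<open>The numbers inside entr below are the eigenvalues of the two channel outputs for an input of spectrum q
with sum 1: the channels act as the second quantization of the input on the k-particle space and, up to
transposition and a shift by the identity, on the (k - 1)-particle space.\<close>

definition cloner_entropy :: "nat \<Rightarrow> nat \<Rightarrow> (nat \<Rightarrow> real) \<Rightarrow> real" where
  "cloner_entropy d k q =
     - (\<Sum>m\<in>occ d k. entr ((\<Sum>i<d. q i * real (m i)) / real ((k + d - 1) choose d)))"

definition compl_entropy :: "nat \<Rightarrow> nat \<Rightarrow> (nat \<Rightarrow> real) \<Rightarrow> real" where
  "compl_entropy d k q =
     - (\<Sum>j\<in>occ d (k - 1). entr ((\<Sum>i<d. q i * (1 + real (j i))) / real ((k + d - 1) choose d)))"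

text \<open>For a fixed environment state j the isometry creates one particle of mode
  \<open>psi\<close> on top of j, divided by sqrt C. Moving the creation operator to
  \<open>f\<close> gives the conjugated annihilation amplitude.\<close>

lemma cinner_on_cl_vec:
  assumes k: "k = Suc n" and j: "j \<in> occ d n"
  shows "cinner_on (occ d k) f (\<lambda>m. cl_vec d k psi m j)
    = cnj (annihilate d psi f j) / sqrt (real ((k + d - 1) choose d))"
proof -
  have "cinner_on (occ d k) f (\<lambda>m. cl_vec d k psi m j) = (\<Sum>l<d. \<Sum>m\<in>occ d k. cnj (f m) * (psi l * cl_amp d k l m j))"
    unfolding cinner_on_def cl_vec_def sum_distrib_left by (rule sum.swap)
  also have "\<dots> = (\<Sum>l<d. cnj (f (j(l := j l + 1))) * (psi l * (sqrt (1 + real (j l)) / sqrt (real ((k + d - 1) choose d)))))"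
  proof (rule sum.cong[OF refl])
    fix l assume "l \<in> {..<d}"
    then have l: "l < d" by simp
    have "(\<Sum>m\<in>occ d k. cnj (f m) * (psi l * cl_amp d k l m j))
      = (\<Sum>m\<in>occ d k. if m = j(l := j l + 1) then cnj (f m) * (psi l * sqrt ((1 + real (j l)) / real ((k + d - 1) choose d))) else 0)"
      using l j k by (intro sum.cong refl) (simp add: cl_amp_def)
    also have "\<dots> = cnj (f (j(l := j l + 1))) * (psi l * sqrt ((1 + real (j l)) / real ((k + d - 1) choose d)))"
      using occ_raise[OF l j] k by (simp only: sum.delta finite_occ if_True)
    finally show "(\<Sum>m\<in>occ d k. cnj (f m) * (psi l * cl_amp d k l m j))
      = cnj (f (j(l := j l + 1))) * (psi l * (sqrt (1 + real (j l)) / sqrt (real ((k + d - 1) choose d))))"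
      by (simp add: real_sqrt_divide)
  qed
  also have "\<dots> = cnj (annihilate d psi f j) / sqrt (real ((k + d - 1) choose d))"
    unfolding annihilate_def cnj_sum sum_divide_distrib by (intro sum.cong refl) (simp add: mult_ac)
  finally show ?thesis .
qed

text \<open>The counterpart on E. The pairing with \<open>g\<close> carries no conjugation, and this
  is where the transposition in the complementary channel originates.\<close>

lemma sum_cl_vec:
  assumes k: "k = Suc n" and m: "m \<in> occ d k"
  shows "(\<Sum>j\<in>occ d n. g j * cl_vec d k psi m j) = create d psi g m / sqrt (real ((k + d - 1) choose d))"
proof -
  have "(\<Sum>j\<in>occ d n. g j * cl_vec d k psi m j) = (\<Sum>l<d. \<Sum>j\<in>occ d n. g j * (psi l * cl_amp d k l m j))"
    unfolding cl_vec_def sum_distrib_left by (rule sum.swap)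
  also have "\<dots> = (\<Sum>l<d. psi l * sqrt (real (m l)) * g (m(l := m l - 1)) / sqrt (real ((k + d - 1) choose d)))"
  proof (rule sum.cong[OF refl])
    fix l assume "l \<in> {..<d}"
    then have l: "l < d" by simp
    show "(\<Sum>j\<in>occ d n. g j * (psi l * cl_amp d k l m j))
      = psi l * sqrt (real (m l)) * g (m(l := m l - 1)) / sqrt (real ((k + d - 1) choose d))"
    proof (cases "m l = 0")
      case True
      have "m \<noteq> j(l := j l + 1)" for j
      proof
        assume "m = j(l := j l + 1)"
        then have "m l = j l + 1" by simp
        with True show False by simp
      qed
      then have "cl_amp d k l m j = 0" for j by (auto simp: cl_amp_def)
      then show ?thesis using True by simp
    next
      case False
      have raise: "m = j(l := j l + 1) \<longleftrightarrow> j = m(l := m l - 1)" for j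
        using False by auto
      have "(\<Sum>j\<in>occ d n. g j * (psi l * cl_amp d k l m j))
        = (\<Sum>j\<in>occ d n. if j = m(l := m l - 1) then g j * (psi l * sqrt (real (m l) / real ((k + d - 1) choose d))) else 0)"
        using l k False by (intro sum.cong refl) (auto simp: cl_amp_def raise of_nat_diff)
      also have "\<dots> = g (m(l := m l - 1)) * (psi l * sqrt (real (m l) / real ((k + d - 1) choose d)))"
        using occ_lower[OF l m[unfolded k] False] by (simp only: sum.delta finite_occ if_True)
      finally show ?thesis by (simp add: real_sqrt_divide)
    qed
  qed
  also have "\<dots> = create d psi g m / sqrt (real ((k + d - 1) choose d))"
    unfolding create_def sum_divide_distrib ..
  finally show ?thesis .
qed

text \<open>Says that the output on B is a*(psi) a(psi) / C on the k-particle space.\<close>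

lemma cloner_out_form:
  assumes k: "k = Suc n"
  shows "(\<Sum>m\<in>occ d k. \<Sum>m'\<in>occ d k. cnj (f m) * cloner_out d k psi m m' * g m')
    = cinner_on (occ d n) (annihilate d psi f) (annihilate d psi g) / real ((k + d - 1) choose d)"
proof -
  let ?C = "real ((k + d - 1) choose d)"
  have "(\<Sum>m\<in>occ d k. \<Sum>m'\<in>occ d k. cnj (f m) * cloner_out d k psi m m' * g m')
    = (\<Sum>m\<in>occ d k. \<Sum>m'\<in>occ d k. cnj (f m) *
        (\<Sum>j\<in>occ d n. 1 * cl_vec d k psi m j * cnj (cl_vec d k psi m' j)) * g m')"
    by (simp add: cloner_out_def k)
  also have "\<dots> = (\<Sum>j\<in>occ d n. 1 * cinner_on (occ d k) f (\<lambda>m. cl_vec d k psi m j)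
      * cinner_on (occ d k) (\<lambda>m. cl_vec d k psi m j) g)"
    by (rule quadratic_form_rank_one_sum)
  also have "\<dots> = (\<Sum>j\<in>occ d n. cnj (annihilate d psi f j) / sqrt ?C * (annihilate d psi g j / sqrt ?C))"
    by (intro sum.cong refl, subst (2) cinner_on_commute) (simp add: cinner_on_cl_vec[OF k])
  also have "\<dots> = (\<Sum>j\<in>occ d n. cnj (annihilate d psi f j) * annihilate d psi g j / ?C)"
    by (intro sum.cong refl) (simp flip: of_real_mult)
  finally show ?thesis by (simp add: cinner_on_def sum_divide_distrib)
qed

text \<open>Says that the output on E is the transpose of a(psi) a*(psi) / C on the space of n = k-1
  particles: \<open>f\<close> enters without and \<open>g\<close> with conjugation, and they change
  places on the right.\<close>

lemma compl_out_form:
  assumes k: "k = Suc n"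
  shows "(\<Sum>j\<in>occ d n. \<Sum>j'\<in>occ d n. f j * compl_out d k psi j j' * cnj (g j'))
    = cinner_on (occ d k) (create d psi g) (create d psi f) / real ((k + d - 1) choose d)"
proof -
  let ?C = "real ((k + d - 1) choose d)"
  have "(\<Sum>j\<in>occ d n. \<Sum>j'\<in>occ d n. f j * compl_out d k psi j j' * cnj (g j'))
    = (\<Sum>j\<in>occ d n. \<Sum>j'\<in>occ d n. cnj (cnj (f j)) *
        (\<Sum>m\<in>occ d k. 1 * cl_vec d k psi m j * cnj (cl_vec d k psi m j')) * cnj (g j'))"
    by (simp add: compl_out_def)
  also have "\<dots> = (\<Sum>m\<in>occ d k. 1 * cinner_on (occ d n) (\<lambda>j. cnj (f j)) (cl_vec d k psi m)
      * cinner_on (occ d n) (cl_vec d k psi m) (\<lambda>j. cnj (g j)))"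
    by (rule quadratic_form_rank_one_sum)
  also have "\<dots> = (\<Sum>m\<in>occ d k. create d psi f m / sqrt ?C * cnj (create d psi g m / sqrt ?C))"
  proof (rule sum.cong[OF refl])
    fix m assume m: "m \<in> occ d k"
    have "cinner_on (occ d n) (\<lambda>j. cnj (h j)) (cl_vec d k psi m) = create d psi h m / sqrt ?C" for h
      using sum_cl_vec[OF k m, of h] by (simp add: cinner_on_def)
    then show "1 * cinner_on (occ d n) (\<lambda>j. cnj (f j)) (cl_vec d k psi m)
      * cinner_on (occ d n) (cl_vec d k psi m) (\<lambda>j. cnj (g j)) = create d psi f m / sqrt ?C * cnj (create d psi g m / sqrt ?C)"
      by (subst (2) cinner_on_commute) simp
  qed
  also have "\<dots> = (\<Sum>m\<in>occ d k. cnj (create d psi g m) * create d psi f m / ?C)"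
    by (intro sum.cong refl) (simp add: mult_ac flip: of_real_mult)
  finally show ?thesis by (simp add: cinner_on_def sum_divide_distrib)
qed

section \<open>Linearity of both channels in the input density matrix\<close>

lemma cloner_out_bilinear:
  "cloner_out d k psi m m' =
    (\<Sum>a<d. \<Sum>b<d. (psi a * cnj (psi b)) * (\<Sum>j\<in>occ d (k - 1). cl_amp d k a m j * cnj (cl_amp d k b m' j)))"
proof -
  have "cloner_out d k psi m m' = (\<Sum>j\<in>occ d (k - 1). \<Sum>a<d. \<Sum>b<d.
      (psi a * cnj (psi b)) * (cl_amp d k a m j * cnj (cl_amp d k b m' j)))"
    unfolding cloner_out_def cl_vec_def cnj_sum sum_product by (simp add: mult_ac)
  also have "\<dots> = (\<Sum>a<d. \<Sum>j\<in>occ d (k - 1). \<Sum>b<d.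
      (psi a * cnj (psi b)) * (cl_amp d k a m j * cnj (cl_amp d k b m' j)))"
    by (rule sum.swap)
  also have "\<dots> = (\<Sum>a<d. \<Sum>b<d. \<Sum>j\<in>occ d (k - 1).
      (psi a * cnj (psi b)) * (cl_amp d k a m j * cnj (cl_amp d k b m' j)))"
    by (intro sum.cong refl sum.swap)
  finally show ?thesis by (simp add: sum_distrib_left)
qed

lemma compl_out_bilinear:
  "compl_out d k psi j j' =
    (\<Sum>a<d. \<Sum>b<d. (psi a * cnj (psi b)) * (\<Sum>m\<in>occ d k. cl_amp d k a m j * cnj (cl_amp d k b m j')))"
proof -
  have "compl_out d k psi j j' = (\<Sum>m\<in>occ d k. \<Sum>a<d. \<Sum>b<d.
      (psi a * cnj (psi b)) * (cl_amp d k a m j * cnj (cl_amp d k b m j')))"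
    unfolding compl_out_def cl_vec_def cnj_sum sum_product by (simp add: mult_ac)
  also have "\<dots> = (\<Sum>a<d. \<Sum>m\<in>occ d k. \<Sum>b<d.
      (psi a * cnj (psi b)) * (cl_amp d k a m j * cnj (cl_amp d k b m j')))"
    by (rule sum.swap)
  also have "\<dots> = (\<Sum>a<d. \<Sum>b<d. \<Sum>m\<in>occ d k.
      (psi a * cnj (psi b)) * (cl_amp d k a m j * cnj (cl_amp d k b m j')))"
    by (intro sum.cong refl sum.swap)
  finally show ?thesis by (simp add: sum_distrib_left)
qed

lemma sum_bilinear:
  assumes F: "\<And>psi :: nat \<Rightarrow> complex. F psi = (\<Sum>a<d. \<Sum>b<d. (psi a * cnj (psi b)) * K a b)"
  shows "(\<Sum>y\<in>Y. c y * F (psi y)) = (\<Sum>a<d. \<Sum>b<d. (\<Sum>y\<in>Y. c y * psi y a * cnj (psi y b)) * K a b)"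
proof -
  have "(\<Sum>y\<in>Y. c y * F (psi y)) = (\<Sum>y\<in>Y. \<Sum>a<d. \<Sum>b<d. c y * psi y a * cnj (psi y b) * K a b)"
    unfolding F sum_distrib_left by (simp add: mult_ac)
  also have "\<dots> = (\<Sum>a<d. \<Sum>y\<in>Y. \<Sum>b<d. c y * psi y a * cnj (psi y b) * K a b)"
    by (rule sum.swap)
  also have "\<dots> = (\<Sum>a<d. \<Sum>b<d. \<Sum>y\<in>Y. c y * psi y a * cnj (psi y b) * K a b)"
    by (intro sum.cong refl sum.swap)
  finally show ?thesis by (simp add: sum_distrib_right)
qed

text \<open>A matrix entry of a channel output sees \<open>psi\<close> only through |psi><psi|, so
  an ensemble may be replaced by the eigendecomposition of its average.\<close>

lemma sum_bilinear_eq: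
  assumes F: "\<And>psi :: nat \<Rightarrow> complex. F psi = (\<Sum>a<d. \<Sum>b<d. (psi a * cnj (psi b)) * K a b)"
    and eq: "\<And>a b. a < d \<Longrightarrow> b < d \<Longrightarrow>
       (\<Sum>y\<in>Y. c y * psi y a * cnj (psi y b)) = (\<Sum>z\<in>Z. c' z * v z a * cnj (v z b))"
  shows "(\<Sum>y\<in>Y. c y * F (psi y)) = (\<Sum>z\<in>Z. c' z * F (v z))"
  unfolding sum_bilinear[OF F] by (intro sum.cong refl) (simp add: eq)

lemma sum_quadratic_form:
  "(\<Sum>a\<in>I. \<Sum>b\<in>J. u a * (\<Sum>i\<in>K. c i * M i a b) * w b) = (\<Sum>i\<in>K. c i * (\<Sum>a\<in>I. \<Sum>b\<in>J. u a * M i a b * w b))"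
  for u :: "'a \<Rightarrow> complex"
proof -
  have "(\<Sum>a\<in>I. \<Sum>b\<in>J. u a * (\<Sum>i\<in>K. c i * M i a b) * w b) = (\<Sum>a\<in>I. \<Sum>i\<in>K. \<Sum>b\<in>J. c i * (u a * M i a b * w b))"
    unfolding sum_distrib_left sum_distrib_right
    by (intro sum.cong refl, subst sum.swap) (simp add: mult_ac)
  also have "\<dots> = (\<Sum>i\<in>K. \<Sum>a\<in>I. \<Sum>b\<in>J. c i * (u a * M i a b * w b))"
    by (rule sum.swap)
  finally show ?thesis by (simp add: sum_distrib_left)
qed

text \<open>After the replacement of the ensemble by the modes \<open>v\<close>, the output is the
  sum of q i / C times the number operator of mode i, which is diagonal in the number
  states.\<close>

theorem vN_entropy_cloner:
  assumes v: "orthonormal_on {..<d} {..<d} v" and k: "k \<ge> 1"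
    and eq: "\<And>a b. a < d \<Longrightarrow> b < d \<Longrightarrow>
       (\<Sum>y\<in>Y. c y * psi y a * cnj (psi y b)) = (\<Sum>i<d. of_real (q i) * v i a * cnj (v i b))"
  shows "vN_entropy (occ d k) (\<lambda>m m'. \<Sum>y\<in>Y. c y * cloner_out d k (psi y) m m') = cloner_entropy d k q"
  unfolding cloner_entropy_def
proof (rule vN_entropy_diagonalized[OF finite_occ])
  obtain n where k: "k = Suc n" using k by (cases k) auto
  let ?C = "real ((k + d - 1) choose d)"
  show "orthonormal_on (occ d k) (occ d k) (fock d v k)"
    by (rule orthonormal_fock[OF v])
  fix a b assume ab: "a \<in> occ d k" "b \<in> occ d k"
  have sum_eq: "(\<Sum>y\<in>Y. c y * cloner_out d k (psi y) m m') = (\<Sum>i<d. of_real (q i) * cloner_out d k (v i) m m')" for m m'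
    by (rule sum_bilinear_eq[OF cloner_out_bilinear eq])
  have form: "(\<Sum>m\<in>occ d k. \<Sum>m'\<in>occ d k. cnj (fock d v k a m) * cloner_out d k (v i) m m' * fock d v k b m')
      = (if a = b then of_nat (a i) else 0) / ?C" if i: "i < d" for i
  proof -
    have "cinner_on (occ d n) (annihilate d (v i) (fock d v k a)) (annihilate d (v i) (fock d v k b))
      = cinner_on (occ d n) (\<lambda>j. of_real (sqrt (real (a i))) * fock d v n (a(i := a i - 1)) j)
           (\<lambda>j. of_real (sqrt (real (b i))) * fock d v n (b(i := b i - 1)) j)"
      unfolding k by (rule cinner_on_cong) (rule annihilate_fock_Suc[OF v i])+
    also have "\<dots> = (if a = b then of_nat (a i) else 0)"
      using lowered_fock_inner[OF orthonormal_fock[OF v] _ _ i] ab unfolding k cinner_on_scale by simp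
    finally show ?thesis unfolding cloner_out_form[OF k] by simp
  qed
  show "(\<Sum>m\<in>occ d k. \<Sum>m'\<in>occ d k. cnj (fock d v k a m) * (\<Sum>y\<in>Y. c y * cloner_out d k (psi y) m m') * fock d v k b m') =
     (if a = b then of_real ((\<Sum>i<d. q i * real (a i)) / ?C) else 0)"
    unfolding sum_eq sum_quadratic_form by (simp add: form sum_divide_distrib)
qed

text \<open>Adjointness lowers the particle number, so the vacuum case is separate; there both sides
  are 0. The arguments appear in the order b, a to fit the transposed form of the complementary
  output.\<close>

lemma number_operator_fock:
  assumes v: "orthonormal_on {..<d} {..<d} v" and i: "i < d" and ab: "a \<in> occ d n" "b \<in> occ d n"
  shows "cinner_on (occ d n) (create d (v i) (annihilate d (v i) (fock d v n b))) (fock d v n a)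
    = (if a = b then of_nat (a i) else 0)"
proof (cases n)
  case 0
  then show ?thesis using ab by (simp add: occ_eq_0 cinner_on_def create_def)
next
  case (Suc n')
  have "cinner_on (occ d n) (create d (v i) (annihilate d (v i) (fock d v n b))) (fock d v n a)
    = cnj (cinner_on (occ d n') (annihilate d (v i) (fock d v n a)) (annihilate d (v i) (fock d v n b)))"
    unfolding Suc create_annihilate_adjoint[symmetric] by (rule cinner_on_commute)
  also have "cinner_on (occ d n') (annihilate d (v i) (fock d v n a)) (annihilate d (v i) (fock d v n b))
      = cinner_on (occ d n') (\<lambda>j. of_real (sqrt (real (a i))) * fock d v n' (a(i := a i - 1)) j)
           (\<lambda>j. of_real (sqrt (real (b i))) * fock d v n' (b(i := b i - 1)) j)"
    unfolding Suc by (rule cinner_on_cong) (rule annihilate_fock_Suc[OF v i])+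
  also have "\<dots> = (if a = b then of_nat (a i) else 0)"
    using lowered_fock_inner[OF orthonormal_fock[OF v] _ _ i] ab unfolding Suc cinner_on_scale by simp
  finally show ?thesis by simp
qed

theorem vN_entropy_compl:
  assumes v: "orthonormal_on {..<d} {..<d} v" and k: "k \<ge> 1"
    and eq: "\<And>a b. a < d \<Longrightarrow> b < d \<Longrightarrow>
       (\<Sum>y\<in>Y. c y * psi y a * cnj (psi y b)) = (\<Sum>i<d. of_real (q i) * v i a * cnj (v i b))"
  shows "vN_entropy (occ d (k - 1)) (\<lambda>j j'. \<Sum>y\<in>Y. c y * compl_out d k (psi y) j j') = compl_entropy d k q"
proof -
  obtain n where k: "k = Suc n" using k by (cases k) auto
  then have n: "k - 1 = n" by simp
  let ?C = "real ((k + d - 1) choose d)"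
  have orth: "orthonormal_on (occ d n) (occ d n) (fock d v n)"
    by (rule orthonormal_fock[OF v])
  have conj: "cinner_on I (\<lambda>j. cnj (f j)) (\<lambda>j. cnj (g j)) = cinner_on I g f" for I and f g :: "(nat \<Rightarrow> nat) \<Rightarrow> complex"
    by (simp add: cinner_on_def mult.commute)
  show ?thesis
    unfolding compl_entropy_def
  proof (rule vN_entropy_diagonalized[OF finite_occ])
    \<comment> \<open>Because of the transposition, the eigenvectors on E are the complex conjugates
      of the number states.\<close>
    show "orthonormal_on (occ d (k - 1)) (occ d (k - 1)) (\<lambda>a j. cnj (fock d v n a j))"
      using orth unfolding orthonormal_on_def n conj by auto
    fix a b assume "a \<in> occ d (k - 1)" "b \<in> occ d (k - 1)"
    then have ab: "a \<in> occ d n" "b \<in> occ d n" by (simp_all only: n)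
    have sum_eq: "(\<Sum>y\<in>Y. c y * compl_out d k (psi y) j j') = (\<Sum>i<d. of_real (q i) * compl_out d k (v i) j j')" for j j'
      by (rule sum_bilinear_eq[OF compl_out_bilinear eq])
    have form: "(\<Sum>j\<in>occ d n. \<Sum>j'\<in>occ d n. fock d v n a j * compl_out d k (v i) j j' * cnj (fock d v n b j'))
        = (if a = b then 1 + of_nat (a i) else 0) / ?C" if i: "i < d" for i
    proof -
      have vi: "cinner_on {..<d} (v i) (v i) = 1"
        using v i by (simp add: orthonormal_on_def)
      \<comment> \<open>Here a a* is rewritten as a* a + 1, so mode i contributes 1 + a i instead of
        a i.\<close>
      have "cinner_on (occ d k) (create d (v i) (fock d v n b)) (create d (v i) (fock d v n a))
        = cinner_on (occ d n) (\<lambda>j. create d (v i) (annihilate d (v i) (fock d v n b)) j + fock d v n b j) (fock d v n a)"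
        unfolding k create_annihilate_adjoint by (rule cinner_on_cong) (simp_all add: canonical_commutation vi)
      also have "\<dots> = cinner_on (occ d n) (create d (v i) (annihilate d (v i) (fock d v n b))) (fock d v n a)
          + cinner_on (occ d n) (fock d v n b) (fock d v n a)"
        by (simp add: cinner_on_def distrib_right sum.distrib)
      also have "\<dots> = (if a = b then 1 + of_nat (a i) else 0)"
        using orth ab by (simp add: number_operator_fock[OF v i ab] orthonormal_on_def)
      finally show ?thesis unfolding compl_out_form[OF k] by simp
    qed
    show "(\<Sum>j\<in>occ d (k - 1). \<Sum>j'\<in>occ d (k - 1). cnj (cnj (fock d v n a j)) *
         (\<Sum>y\<in>Y. c y * compl_out d k (psi y) j j') * cnj (fock d v n b j')) =
       (if a = b then of_real ((\<Sum>i<d. q i * (1 + real (a i))) / ?C) else 0)"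
      unfolding sum_eq n complex_cnj_cnj sum_quadratic_form by (simp add: form sum_divide_distrib)
  qed
qed

subsection \<open>Optimization over spectra\<close>

text \<open>Coordinates from d on are pinned to 0 so that the set is compact in the product topology
  on functions from \<open>nat\<close> to \<open>real\<close>.\<close>

definition simplex :: "nat \<Rightarrow> (nat \<Rightarrow> real) set" where
  "simplex d = {q. (\<forall>i<d. q i \<ge> 0) \<and> (\<forall>i\<ge>d. q i = 0) \<and> (\<Sum>i<d. q i) = 1}"

text \<open>The tangent at s lies below the convex function t log t; its slope is log s + 1/ln 2 in
  base 2. For t > 0 this is ln x \<le> x - 1 at x = s/t.\<close>

lemma entr_tangent:
  assumes "s > 0" "t \<ge> 0"
  shows "entr t \<ge> entr s + (t - s) * (log 2 s + 1 / ln 2)"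
proof (cases "t = 0")
  case True
  then show ?thesis using assms by (simp add: entr_def algebra_simps)
next
  case False
  then have t: "t > 0" using assms by simp
  have "ln (s / t) \<le> s / t - 1" using assms t by (intro ln_le_minus_one) simp
  then have "t * (ln s - ln t) \<le> t * (s / t - 1)"
    using assms t by (intro mult_left_mono) (simp_all add: ln_div)
  then have "t * ln t \<ge> s * ln s + (t - s) * (ln s + 1)"
    using t by (simp add: algebra_simps)
  then have "t * ln t / ln 2 \<ge> (s * ln s + (t - s) * (ln s + 1)) / ln 2"
    by (intro divide_right_mono) simp_all
  moreover have "entr s + (t - s) * (log 2 s + 1 / ln 2) = (s * ln s + (t - s) * (ln s + 1)) / ln 2"
    using assms by (simp add: entr_def log_def field_simps)
  ultimately show ?thesis using t by (simp add: entr_def log_def)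
qed

text \<open>Only 0 is delicate: t log t tends to 0 from the right, and \<open>entr\<close> is 0 to
  the left by its definition.\<close>

lemma continuous_on_entr: "continuous_on UNIV entr"
proof -
  have "isCont entr x" for x
  proof -
    consider "x < 0" | "x = 0" | "x > 0" by linarith
    then show ?thesis
    proof cases
      case 1
      then have "\<forall>\<^sub>F t in nhds x. entr t = 0"
        by (intro eventually_mono[OF eventually_nhds_in_open[of "{..<0}"]]) (auto simp: entr_def)
      then show ?thesis by (simp add: isCont_cong)
    next
      case 3
      then have "\<forall>\<^sub>F t in nhds x. entr t = t * log 2 t"
        by (intro eventually_mono[OF eventually_nhds_in_open[of "{0<..}"]]) (auto simp: entr_def)
      moreover have "isCont (\<lambda>t. t * log 2 t) x"
        using 3 unfolding log_def by (intro continuous_intros) auto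
      ultimately show ?thesis by (subst isCont_cong)
    next
      case 2
      have "((\<lambda>t. t * log 2 t) \<longlongrightarrow> 0) (at_right (0::real))"
        unfolding log_def by real_asymp
      then have "(entr \<longlongrightarrow> 0) (at_right 0)"
        by (rule Lim_transform_eventually)
           (auto simp: entr_def eventually_at_right_field intro!: exI[of _ 1])
      moreover have "(entr \<longlongrightarrow> 0) (at_left 0)"
        by (rule Lim_transform_eventually[OF tendsto_const])
           (auto simp: entr_def eventually_at_left_field intro!: exI[of _ "-1"])
      ultimately show ?thesis
        using 2 by (simp add: isCont_def entr_def filterlim_at_split)
    qed
  qed
  then show ?thesis by (simp add: continuous_on_eq_continuous_at)
qed

text \<open>A closed subset of a product of compact sets, unit intervals below d and single points
  beyond, which is compact by Tychonoff's theorem.\<close>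

lemma compact_simplex: "compact (simplex d)"
proof -
  let ?K = "PiE UNIV (\<lambda>i. if i < d then {0..1} else {0 :: real})"
  have "compactin (product_topology (\<lambda>i. euclidean) UNIV) ?K"
    unfolding compactin_PiE by (intro disjI2 ballI) simp
  then have K: "compact ?K" by (simp add: euclidean_product_topology)
  have "continuous_on UNIV (\<lambda>q :: nat \<Rightarrow> real. \<Sum>i<d. q i)"
    by (intro continuous_intros continuous_on_product_coordinates)
  then have "closed {q :: nat \<Rightarrow> real. (\<Sum>i<d. q i) = 1}"
    by (intro closed_Collect_eq continuous_on_const)
  then have "compact (?K \<inter> {q. (\<Sum>i<d. q i) = 1})"
    using K by (rule compact_Int_closed[rotated])
  moreover have "simplex d = ?K \<inter> {q. (\<Sum>i<d. q i) = 1}"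
  proof (intro equalityI subsetI)
    fix q assume q: "q \<in> simplex d"
    then have "q i \<le> 1" if "i < d" for i
      using member_le_sum[of i "{..<d}" q] that by (simp add: simplex_def)
    then show "q \<in> ?K \<inter> {q. (\<Sum>i<d. q i) = 1}" using q by (auto simp: simplex_def PiE_iff)
  next
    fix q assume "q \<in> ?K \<inter> {q. (\<Sum>i<d. q i) = 1}"
    then have q: "\<And>i. q i \<in> (if i < d then {0..1} else {0})" "(\<Sum>i<d. q i) = 1"
      by (auto simp: PiE_iff)
    have "q i \<ge> 0" if "i < d" for i using q(1)[of i] that by simp
    moreover have "q i = 0" if "i \<ge> d" for i using q(1)[of i] that by simp
    ultimately show "q \<in> simplex d" using q(2) by (simp add: simplex_def)
  qed
  ultimately show ?thesis by simp
qed

lemma simplex_indicator: "i < d \<Longrightarrow> (\<lambda>j. if j = i then 1 else 0) \<in> simplex d"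
  by (simp add: simplex_def)

lemma continuous_on_cloner_entropy: "continuous_on A (cloner_entropy d k)"
  unfolding cloner_entropy_def divide_inverse
  by (intro continuous_intros continuous_on_compose2[OF continuous_on_entr]
      continuous_on_subset[OF continuous_on_product_coordinates]) auto

lemma continuous_on_compl_entropy: "continuous_on A (compl_entropy d k)"
  unfolding compl_entropy_def divide_inverse
  by (intro continuous_intros continuous_on_compose2[OF continuous_on_entr]
      continuous_on_subset[OF continuous_on_product_coordinates]) auto

lemma cloner_entropy_cong: "(\<And>i. i < d \<Longrightarrow> q i = q' i) \<Longrightarrow> cloner_entropy d k q = cloner_entropy d k q'"
  unfolding cloner_entropy_def by simp

lemma compl_entropy_cong: "(\<And>i. i < d \<Longrightarrow> q i = q' i) \<Longrightarrow> compl_entropy d k q = compl_entropy d k q'"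
  unfolding compl_entropy_def by simp

lemma sum_occ_coordinate:
  assumes "i < d" "i' < d"
  shows "(\<Sum>m\<in>occ d k. real (m i)) = (\<Sum>m\<in>occ d k. real (m i'))"
proof (rule sum.reindex_bij_witness[where i = "\<lambda>m. m \<circ> Transposition.transpose i i'" and j = "\<lambda>m. m \<circ> Transposition.transpose i i'"])
  fix m assume m: "m \<in> occ d k"
  have "bij_betw (Transposition.transpose i i') {..<d} {..<d}"
    using assms by simp
  then have "(\<Sum>l<d. m (Transposition.transpose i i' l)) = (\<Sum>l<d. m l)"
    by (rule sum.reindex_bij_betw)
  then show "m \<circ> Transposition.transpose i i' \<in> occ d k" "m \<circ> Transposition.transpose i i' \<in> occ d k"
    using m assms by (auto simp: occ_def Transposition.transpose_def)
qed (auto simp: comp_def)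

text \<open>Jensen's inequality by tangents: by symmetry of the modes the sum of all eigenvalues
  depends on q only through its total 1, so the linear terms of the tangent at the common value
  cancel.\<close>

lemma cloner_entropy_le_uniform:
  assumes d: "d \<ge> 1" and k: "k \<ge> 1" and q: "\<And>i. i < d \<Longrightarrow> q i \<ge> 0" "(\<Sum>i<d. q i) = 1"
  shows "cloner_entropy d k q \<le> cloner_entropy d k (\<lambda>_. 1 / real d)"
proof -
  define C where "C = real ((k + d - 1) choose d)"
  \<comment> \<open>The eigenvalue for the uniform spectrum, the same for every m because the
    entries of m add up to k.\<close>
  define s where "s = real k / real d / C"
  define t where "t m = (\<Sum>i<d. q i * real (m i)) / C" for m
  have C: "C > 0" using k by (simp add: C_def)
  have s: "s > 0" using C k d by (simp add: s_def)
  have t: "t m \<ge> 0" for m using C q(1) by (auto simp: t_def intro!: divide_nonneg_pos sum_nonneg)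
  have unif: "(\<Sum>i<d. 1 / real d * real (m i)) / C = s" if "m \<in> occ d k" for m
    using that by (auto simp: occ_def s_def simp flip: sum_divide_distrib of_nat_sum)
  have total: "(\<Sum>m\<in>occ d k. (\<Sum>i<d. r i * real (m i)) / C) = (\<Sum>m\<in>occ d k. real (m 0)) / C"
    if r: "(\<Sum>i<d. r i) = 1" for r
  proof -
    have "(\<Sum>m\<in>occ d k. \<Sum>i<d. r i * real (m i)) = (\<Sum>i<d. r i * (\<Sum>m\<in>occ d k. real (m i)))"
      unfolding sum_distrib_left by (rule sum.swap)
    also have "\<dots> = (\<Sum>i<d. r i * (\<Sum>m\<in>occ d k. real (m 0)))"
      using d by (intro sum.cong refl arg_cong2[where f = "(*)"] sum_occ_coordinate) auto
    also have "\<dots> = (\<Sum>m\<in>occ d k. real (m 0))"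
      using r by (simp flip: sum_distrib_right)
    finally show ?thesis by (simp flip: sum_divide_distrib)
  qed
  have "(\<Sum>m\<in>occ d k. t m) = (\<Sum>m\<in>occ d k. (\<Sum>i<d. 1 / real d * real (m i)) / C)"
    unfolding t_def using d by (subst (1 2) total) (simp_all add: q(2))
  also have "\<dots> = (\<Sum>m\<in>occ d k. s)" using unif by (intro sum.cong refl) auto
  finally have "(\<Sum>m\<in>occ d k. t m - s) = 0" by (simp add: sum_subtractf)
  then have "(\<Sum>m\<in>occ d k. (t m - s) * (log 2 s + 1 / ln 2)) = 0"
    by (simp flip: sum_distrib_right)
  then have "(\<Sum>m\<in>occ d k. entr s) = (\<Sum>m\<in>occ d k. entr s + (t m - s) * (log 2 s + 1 / ln 2))"
    by (simp add: sum.distrib)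
  also have "\<dots> \<le> (\<Sum>m\<in>occ d k. entr (t m))"
    using s t by (intro sum_mono entr_tangent) auto
  finally have "(\<Sum>m\<in>occ d k. entr s) \<le> (\<Sum>m\<in>occ d k. entr (t m))" .
  moreover have "cloner_entropy d k (\<lambda>_. 1 / real d) = - (\<Sum>m\<in>occ d k. entr s)"
    unfolding cloner_entropy_def C_def[symmetric] using unif
    by (intro arg_cong[where f = uminus] sum.cong refl arg_cong[where f = entr]) auto
  moreover have "cloner_entropy d k q = - (\<Sum>m\<in>occ d k. entr (t m))"
    by (simp add: cloner_entropy_def t_def C_def)
  ultimately show ?thesis by simp
qed

subsection \<open>The private dynamic objective\<close>

text \<open>The point is that a single spectrum serves both outputs, so a difference of entropies on
  B and E becomes a function of one q.\<close>

lemma mixture_entropies: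
  fixes p :: "'y \<Rightarrow> real" and psi :: "'y \<Rightarrow> nat \<Rightarrow> complex"
  assumes k: "k \<ge> 1"
    and p: "\<And>y. y \<in> Y \<Longrightarrow> p y \<ge> 0" "sum p Y = 1"
    and unit: "\<And>y. y \<in> Y \<Longrightarrow> cinner_on {..<d} (psi y) (psi y) = 1"
  shows "\<exists>q\<in>simplex d.
    vN_entropy (occ d k) (\<lambda>m m'. \<Sum>y\<in>Y. of_real (p y) * cloner_out d k (psi y) m m') = cloner_entropy d k q \<and>
    vN_entropy (occ d (k - 1)) (\<lambda>j j'. \<Sum>y\<in>Y. of_real (p y) * compl_out d k (psi y) j j') = compl_entropy d k q"
proof -
  obtain v q where v: "orthonormal_on {..<d} {..<d} v" and q: "\<forall>i<d. q i \<ge> 0" "(\<Sum>i<d. q i) = 1"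
    and "\<forall>a<d. \<forall>b<d. (\<Sum>y\<in>Y. of_real (p y) * psi y a * cnj (psi y b))
       = (\<Sum>i<d. of_real (q i) * v i a * cnj (v i b))"
    using density_spectral_decomposition[where Y = Y and p = p and psi = psi and d = d, OF p unit] by blast
  then have eq: "(\<Sum>y\<in>Y. of_real (p y) * psi y a * cnj (psi y b)) = (\<Sum>i<d. of_real (q i) * v i a * cnj (v i b))"
    if "a < d" "b < d" for a b using that by blast
  \<comment> \<open>The decomposition says nothing about q from d on, while \<open>simplex\<close>
    asks for zeros there.\<close>
  let ?q = "\<lambda>i. if i < d then q i else 0"
  have "?q \<in> simplex d" using q by (simp add: simplex_def)
  moreover have "cloner_entropy d k q = cloner_entropy d k ?q" "compl_entropy d k q = compl_entropy d k ?q"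
    by (auto intro: cloner_entropy_cong compl_entropy_cong)
  ultimately show ?thesis
    using vN_entropy_cloner[where c = "\<lambda>y. of_real (p y)" and Y = Y and psi = psi, OF v k eq]
      vN_entropy_compl[where c = "\<lambda>y. of_real (p y)" and Y = Y and psi = psi, OF v k eq] by auto
qed

text \<open>The spectral decomposition of |psi><psi| already provides an orthonormal basis
  containing \<open>psi\<close> up to a phase. Evaluating the squared overlap of \<open>psi\<close>
  with \<open>v i\<close> in two ways gives q i squared = q i, so exactly one weight is 1; a
  transposition moves it to index 0.\<close>

lemma vN_entropy_cloner_pure:
  assumes d: "d \<ge> 1" and k: "k \<ge> 1" and unit: "cinner_on {..<d} psi psi = 1"
  shows "vN_entropy (occ d k) (cloner_out d k psi) = cloner_entropy d k (\<lambda>i. if i = 0 then 1 else 0)"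
proof -
  obtain v q where v: "orthonormal_on {..<d} {..<d} v" and q: "\<forall>i<d. q i \<ge> 0" "(\<Sum>i<d. q i) = 1"
    and "\<forall>a<d. \<forall>b<d. (\<Sum>y\<in>{()}. of_real 1 * psi a * cnj (psi b))
       = (\<Sum>i<d. of_real (q i) * v i a * cnj (v i b))"
    using density_spectral_decomposition[where Y = "{()}" and p = "\<lambda>_. 1" and psi = "\<lambda>_. psi" and d = d] unit by auto
  then have eq: "psi a * cnj (psi b) = (\<Sum>i<d. of_real (q i) * v i a * cnj (v i b))"
    if "a < d" "b < d" for a b using that by simp
  have ipv: "cinner_on {..<d} (v i) (v j) = (if i = j then 1 else 0)" if "i < d" "j < d" for i j
    using v that by (simp add: orthonormal_on_def)
  have idem: "q i = 0 \<or> q i = 1" if i: "i < d" for i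
  proof -
    have eig: "cinner_on {..<d} psi (v i) * psi a = of_real (q i) * v i a" if a: "a < d" for a
    proof -
      have "cinner_on {..<d} psi (v i) * psi a = (\<Sum>b<d. (psi a * cnj (psi b)) * v i b)"
        by (simp add: cinner_on_def sum_distrib_left sum_distrib_right mult_ac)
      also have "\<dots> = (\<Sum>b<d. (\<Sum>j<d. of_real (q j) * v j a * cnj (v j b)) * v i b)"
        using a by (intro sum.cong refl) (simp add: eq)
      also have "\<dots> = (\<Sum>j<d. of_real (q j) * v j a * cinner_on {..<d} (v j) (v i))"
        unfolding cinner_on_def sum_distrib_left sum_distrib_right by (subst sum.swap) (simp add: mult_ac)
      also have "\<dots> = (\<Sum>j<d. if i = j then of_real (q j) * v j a else 0)"
        using i by (intro sum.cong refl) (simp add: ipv)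
      finally show ?thesis using i by simp
    qed
    let ?x = "cinner_on {..<d} psi (v i)"
    have "cnj ?x * ?x = cinner_on {..<d} (\<lambda>a. ?x * psi a) (\<lambda>a. ?x * psi a)"
      by (simp add: cinner_on_scale unit)
    also have "\<dots> = cinner_on {..<d} (\<lambda>a. of_real (q i) * v i a) (\<lambda>a. of_real (q i) * v i a)"
      by (rule cinner_on_cong) (simp_all add: eig)
    also have "\<dots> = of_real (q i * q i)" using i by (simp add: cinner_on_scale ipv)
    finally have 1: "cnj ?x * ?x = of_real (q i * q i)" .
    have "cnj ?x * ?x = cinner_on {..<d} (v i) (\<lambda>a. ?x * psi a)"
      using cinner_on_scale[of "{..<d}" 1 "v i" ?x psi] cinner_on_commute[of "{..<d}" "v i" psi]
      by (simp add: mult.commute)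
    also have "\<dots> = cinner_on {..<d} (v i) (\<lambda>a. of_real (q i) * v i a)"
      by (rule cinner_on_cong) (simp_all add: eig)
    also have "\<dots> = of_real (q i)"
      using cinner_on_scale[of "{..<d}" 1 "v i" "of_real (q i)" "v i"] i by (simp add: ipv)
    finally have "q i * q i = q i" using 1 by (simp only: of_real_eq_iff)
    then show ?thesis by simp
  qed
  obtain i where i: "i < d" "q i = 1"
  proof -
    have "\<exists>i<d. q i \<noteq> 0" using q(2) by (metis (mono_tags, lifting) lessThan_iff sum.neutral zero_neq_one)
    then show ?thesis using idem that by blast
  qed
  have "(\<Sum>j\<in>{..<d} - {i}. q j) = 0"
    using q(2) i sum.remove[of "{..<d}" i q] by simp
  then have others: "q j = 0" if "j < d" "j \<noteq> i" for j
    using that q(1) by (subst (asm) sum_nonneg_eq_0_iff) auto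
  let ?e = "\<lambda>j :: nat. if j = 0 then 1 else 0 :: real"
  have "orthonormal_on {..<d} {..<d} (v \<circ> Transposition.transpose 0 i)"
    using v i d by (auto simp: orthonormal_on_def Transposition.transpose_def)
  moreover have "(\<Sum>y\<in>{()}. 1 * psi a * cnj (psi b)) =
      (\<Sum>j<d. of_real (?e j) * (v \<circ> Transposition.transpose 0 i) j a * cnj ((v \<circ> Transposition.transpose 0 i) j b))"
    if "a < d" "b < d" for a b
  proof -
    have "(\<Sum>y\<in>{()}. 1 * psi a * cnj (psi b)) = (\<Sum>j<d. of_real (q j) * v j a * cnj (v j b))"
      using that by (simp add: eq)
    also have "\<dots> = (\<Sum>j<d. if j = i then v j a * cnj (v j b) else 0)"
      using i others by (intro sum.cong refl) simp
    also have "\<dots> = v i a * cnj (v i b)" using i by simp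
    also have "\<dots> = (\<Sum>j<d. if j = 0 then v i a * cnj (v i b) else 0)" using d by simp
    also have "\<dots> = (\<Sum>j<d. of_real (?e j) * (v \<circ> Transposition.transpose 0 i) j a * cnj ((v \<circ> Transposition.transpose 0 i) j b))"
      by (intro sum.cong refl) simp
    finally show ?thesis .
  qed
  ultimately have "vN_entropy (occ d k) (\<lambda>m m'. \<Sum>y\<in>{()}. 1 * cloner_out d k psi m m') = cloner_entropy d k ?e"
    using k by (intro vN_entropy_cloner[where psi = "\<lambda>_. psi"])
  then show ?thesis by simp
qed

lemma valid_ensemble_D:
  assumes "valid_ensemble d S p psi" "(x, y) \<in> S"
  shows "p x y \<ge> 0" "cinner_on {..<d} (psi x y) (psi x y) = 1"
proof -
  show "p x y \<ge> 0" using assms by (auto simp: valid_ensemble_def)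
  have "(\<Sum>i<d. (cmod (psi x y i))\<^sup>2) = 1" using assms by (auto simp: valid_ensemble_def)
  then have "complex_of_real (\<Sum>i<d. (cmod (psi x y i))\<^sup>2) = 1" by simp
  then show "cinner_on {..<d} (psi x y) (psi x y) = 1"
    by (simp add: cinner_on_def complex_norm_square mult.commute del: of_real_power)
qed

lemma sum_marg_X:
  assumes "finite S"
  shows "(\<Sum>x\<in>fst ` S. marg_X S p x) = (\<Sum>(x, y)\<in>S. p x y)"
proof -
  have "finite {y. (x, y) \<in> S}" for x
    by (rule finite_subset[of _ "snd ` S"]) (use assms in \<open>force+\<close>)
  then have "(\<Sum>x\<in>fst ` S. marg_X S p x) = (\<Sum>(x, y)\<in>Sigma (fst ` S) (\<lambda>x. {y. (x, y) \<in> S}). p x y)"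
    unfolding marg_X_def using assms by (intro sum.Sigma) auto
  also have "Sigma (fst ` S) (\<lambda>x. {y. (x, y) \<in> S}) = S" by force
  finally show ?thesis .
qed

text \<open>Both conditional terms are collected for each label x and bounded by \<open>G\<close>,
  while H(B) enters with total coefficient 1 + mu \<ge> 0.\<close>

theorem pd_objective_le:
  assumes val: "valid_ensemble d S p psi" and d: "d \<ge> 1" and k: "k \<ge> 1" and mu: "mu \<ge> 0"
    and G: "\<And>q. q \<in> simplex d \<Longrightarrow> lam * cloner_entropy d k q - (lam + mu) * compl_entropy d k q \<le> G"
  shows "pd_objective d k lam mu S p psi \<le> (1 + mu) * cloner_entropy d k (\<lambda>_. 1 / real d)
     - cloner_entropy d k (\<lambda>i. if i = 0 then 1 else 0) + G"
proof -
  let ?U = "cloner_entropy d k (\<lambda>_. 1 / real d)"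
  let ?h = "cloner_entropy d k (\<lambda>i. if i = 0 then 1 else 0)"
  have fin: "finite S" and psum: "(\<Sum>(x, y)\<in>S. p x y) = 1"
    using val by (auto simp: valid_ensemble_def)
  have "\<exists>q\<in>simplex d. vN_entropy (occ d k) (\<lambda>m m'. \<Sum>z\<in>S. of_real (case_prod p z) * cloner_out d k (case_prod psi z) m m') = cloner_entropy d k q \<and>
     vN_entropy (occ d (k - 1)) (\<lambda>j j'. \<Sum>z\<in>S. of_real (case_prod p z) * compl_out d k (case_prod psi z) j j') = compl_entropy d k q"
    by (rule mixture_entropies[OF k]) (use valid_ensemble_D[OF val] psum in auto)
  then obtain q where q: "q \<in> simplex d" and "H_B d k S p psi = cloner_entropy d k q"
    by (auto simp: H_B_def avg_state_def[abs_def] split_def)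
  then have HB: "H_B d k S p psi \<le> ?U"
    using cloner_entropy_le_uniform[OF d k, of q] by (simp add: simplex_def)
  have "(\<Sum>(x, y)\<in>S. p x y * vN_entropy (occ d k) (cloner_out d k (psi x y))) = (\<Sum>(x, y)\<in>S. p x y * ?h)"
    using valid_ensemble_D[OF val] vN_entropy_cloner_pure[OF d k] by (intro sum.cong refl) auto
  also have "\<dots> = (\<Sum>(x, y)\<in>S. p x y) * ?h"
    by (simp add: split_def sum_distrib_right)
  finally have I: "I_XY_B d k S p psi = H_B d k S p psi - ?h"
    by (simp add: I_XY_B_def psum)
  let ?b = "\<lambda>x. vN_entropy (occ d k) (cond_state S p psi (cloner_out d k) x)"
  let ?e = "\<lambda>x. vN_entropy (occ d (k - 1)) (cond_state S p psi (compl_out d k) x)"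
  have "marg_X S p x * (lam * ?b x - (lam + mu) * ?e x) \<le> marg_X S p x * G" for x
  \<comment> \<open>A label of probability 0 has no genuine conditional state, since its weights are
    divided by 0, but its term is multiplied by 0.\<close>
  proof (cases "marg_X S p x = 0")
    case False
    have "marg_X S p x \<ge> 0"
      using valid_ensemble_D(1)[OF val] by (auto simp: marg_X_def intro!: sum_nonneg)
    with False have pos: "marg_X S p x > 0" by simp
    have "\<exists>q\<in>simplex d. vN_entropy (occ d k) (\<lambda>m m'. \<Sum>y\<in>{y. (x, y) \<in> S}. of_real (p x y / marg_X S p x) * cloner_out d k (psi x y) m m') = cloner_entropy d k q \<and>
     vN_entropy (occ d (k - 1)) (\<lambda>j j'. \<Sum>y\<in>{y. (x, y) \<in> S}. of_real (p x y / marg_X S p x) * compl_out d k (psi x y) j j') = compl_entropy d k q"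
    proof (rule mixture_entropies[OF k])
      show "(\<Sum>y\<in>{y. (x, y) \<in> S}. p x y / marg_X S p x) = 1"
        using pos unfolding sum_divide_distrib[symmetric] marg_X_def[symmetric] by simp
    qed (use valid_ensemble_D[OF val] pos in auto)
    then obtain q where "q \<in> simplex d" "?b x = cloner_entropy d k q" "?e x = compl_entropy d k q"
      unfolding cond_state_def[abs_def] by blast
    then show ?thesis using G[of q] pos by (intro mult_left_mono) auto
  qed simp
  then have "(\<Sum>x\<in>fst ` S. marg_X S p x * (lam * ?b x - (lam + mu) * ?e x)) \<le> (\<Sum>x\<in>fst ` S. marg_X S p x * G)"
    by (intro sum_mono)
  also have "\<dots> = G" using sum_marg_X[OF fin, of p] psum by (simp flip: sum_distrib_right)
  finally have "lam * H_B_X d k S p psi - (lam + mu) * H_E_X d k S p psi \<le> G"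
    by (simp add: H_B_X_def H_E_X_def right_diff_distrib sum_subtractf sum_distrib_left mult_ac)
  moreover have "(1 + mu) * H_B d k S p psi \<le> (1 + mu) * ?U"
    using HB mu by (intro mult_left_mono) auto
  ultimately show ?thesis unfolding pd_objective_def I by (simp add: algebra_simps)
qed

section \<open>Cyclic shifts and the candidate ensemble\<close>

definition cyc :: "nat \<Rightarrow> nat \<Rightarrow> nat \<Rightarrow> nat" where
  "cyc d x j = nat ((int j - int x) mod int d)"

lemma cyc_less: "d \<ge> 1 \<Longrightarrow> cyc d x j < d"
  by (simp add: cyc_def nat_less_iff)

lemma int_cyc: "d \<ge> 1 \<Longrightarrow> int (cyc d x j) = (int j - int x) mod int d"
  by (simp add: cyc_def)

lemma cyc_cyc:
  assumes "x < d"
  shows "cyc d (cyc d x j) j = x"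
proof -
  have "int (cyc d (cyc d x j) j) = (int j - (int j - int x) mod int d) mod int d"
    using assms by (simp add: int_cyc)
  also have "\<dots> = (int j - (int j - int x)) mod int d" by (simp only: mod_diff_right_eq)
  also have "\<dots> = int x" using assms by simp
  finally show ?thesis by simp
qed

lemma cyc_shift:
  assumes "i < d"
  shows "cyc d x ((i + x) mod d) = i"
proof -
  have "int (cyc d x ((i + x) mod d)) = ((int i + int x) mod int d - int x) mod int d"
    using assms by (simp add: int_cyc zmod_int)
  also have "\<dots> = (int i + int x - int x) mod int d" by (simp only: mod_diff_left_eq)
  also have "\<dots> = int i" using assms by simp
  finally show ?thesis by simp
qed

lemma shift_cyc:
  assumes "j < d"
  shows "(cyc d x j + x) mod d = j"
proof -
  have "int ((cyc d x j + x) mod d) = ((int j - int x) mod int d + int x) mod int d"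
    using assms by (simp add: int_cyc zmod_int)
  also have "\<dots> = (int j - int x + int x) mod int d" by (simp only: mod_add_left_eq)
  also have "\<dots> = int j" using assms by simp
  finally show ?thesis by simp
qed

text \<open>Bijectivity in j for fixed x: each conditional input is a relabelling of the spectrum
  q.\<close>

lemma sum_cyc: "(\<Sum>j<d. f j (cyc d x j)) = (\<Sum>i<d. f ((i + x) mod d) i)" if "d \<ge> 1"
  by (rule sum.reindex_bij_witness[where i = "\<lambda>i. (i + x) mod d" and j = "cyc d x"])
    (use that in \<open>auto simp: cyc_less cyc_shift shift_cyc\<close>)

text \<open>Bijectivity in x for fixed j, as x \<mapsto> j - x is an involution modulo d: the
  average input is maximally mixed.\<close>

lemma sum_cyc_left: "(\<Sum>x<d. f (cyc d x j)) = (\<Sum>i<d. f i)" if "d \<ge> 1"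
  by (rule sum.reindex_bij_witness[where i = "\<lambda>i. cyc d i j" and j = "\<lambda>x. cyc d x j"])
    (use that in \<open>auto simp: cyc_less cyc_cyc\<close>)

text \<open>Lets the maximizer q itself serve as the parameter \<nu>, since its value at 0 is
  recovered from normalization.\<close>

lemma q_weight_simplex:
  assumes "q \<in> simplex d" "d \<ge> 1" "m < d"
  shows "q_weight d q m = q m"
proof -
  have "{..<d} = insert 0 {1..<d}" using assms by auto
  then have "q 0 + (\<Sum>i\<in>{1..<d}. q i) = 1" using assms by (simp add: simplex_def)
  then show ?thesis by (auto simp: q_weight_def)
qed

lemma opt_p_simplex:
  assumes "q \<in> simplex d" "d \<ge> 1"
  shows "opt_p d q x j = q (cyc d x j) / real d"
  using q_weight_simplex[OF assms, of "cyc d x j"] cyc_less[OF assms(2)]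
  by (simp add: opt_p_def cyc_def)

lemma sum_simplex: "q \<in> simplex d \<Longrightarrow> (\<Sum>i<d. q i) = 1"
  and simplex_nonneg: "q \<in> simplex d \<Longrightarrow> i < d \<Longrightarrow> q i \<ge> 0"
  by (simp_all add: simplex_def)

lemma opt_valid:
  assumes q: "q \<in> simplex d" and d: "d \<ge> 1"
  shows "valid_ensemble d (opt_S d) (opt_p d q) opt_psi"
proof -
  have "(\<Sum>(x, y)\<in>opt_S d. opt_p d q x y) = (\<Sum>x<d. \<Sum>y<d. q (cyc d x y) / real d)"
    unfolding opt_S_def by (simp add: sum.cartesian_product opt_p_simplex[OF q d] lessThan_atLeast0)
  also have "\<dots> = (\<Sum>x<d. (\<Sum>i<d. q i) / real d)"
    using sum_cyc[OF d, of "\<lambda>_ i. q i / real d"] by (simp add: sum_divide_distrib)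
  also have "\<dots> = 1" using d by (simp add: sum_simplex[OF q])
  finally have "(\<Sum>(x, y)\<in>opt_S d. opt_p d q x y) = 1" .
  moreover have "(\<Sum>i<d. (cmod (opt_psi x y i))\<^sup>2) = 1" if "y < d" for x y
  proof -
    have "(\<Sum>i<d. (cmod (opt_psi x y i))\<^sup>2) = (\<Sum>i<d. if i = y then 1 else 0)"
      by (intro sum.cong refl) (simp add: opt_psi_def)
    then show ?thesis using that by simp
  qed
  moreover have "opt_p d q x y \<ge> 0" for x y
    using simplex_nonneg[OF q cyc_less[OF d]] by (simp add: opt_p_simplex[OF q d])
  moreover have "finite (opt_S d)" by (simp add: opt_S_def)
  moreover have "\<forall>i\<ge>d. opt_psi x y i = 0" if "y < d" for x y
    using that by (simp add: opt_psi_def)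
  moreover have "y < d" if "(x, y) \<in> opt_S d" for x y
    using that by (simp add: opt_S_def)
  ultimately show ?thesis unfolding valid_ensemble_def by blast
qed

text \<open>The relabelling \<open>f\<close> is the identity for the average input and a cyclic
  shift for the conditional ones.\<close>

lemma orthonormal_opt_psi:
  assumes "inj_on f {..<d}" "f ` {..<d} \<subseteq> {..<d}"
  shows "orthonormal_on {..<d} {..<d} (\<lambda>i. opt_psi x (f i))"
  unfolding orthonormal_on_def
proof (intro ballI)
  fix i j assume ij: "i \<in> {..<d}" "j \<in> {..<d}"
  have "cinner_on {..<d} (opt_psi x (f i)) (opt_psi x (f j)) = (\<Sum>a<d. if a = f i then (if f i = f j then 1 else 0) else 0)"
    unfolding cinner_on_def by (intro sum.cong refl) (auto simp: opt_psi_def)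
  also have "\<dots> = (if i = j then 1 else 0)"
    using assms ij by (auto simp: inj_on_eq_iff)
  finally show "cinner_on {..<d} (opt_psi x (f i)) (opt_psi x (f j)) = (if i = j then 1 else 0)" .
qed

theorem pd_objective_opt:
  assumes q: "q \<in> simplex d" and d: "d \<ge> 1" and k: "k \<ge> 1"
  shows "pd_objective d k lam mu (opt_S d) (opt_p d q) opt_psi = (1 + mu) * cloner_entropy d k (\<lambda>_. 1 / real d)
     - cloner_entropy d k (\<lambda>i. if i = 0 then 1 else 0) + (lam * cloner_entropy d k q - (lam + mu) * compl_entropy d k q)"
proof -
  let ?U = "cloner_entropy d k (\<lambda>_. 1 / real d)"
  let ?h = "cloner_entropy d k (\<lambda>i. if i = 0 then 1 else 0)"
  let ?S = "opt_S d" and ?p = "opt_p d q"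
  have val: "valid_ensemble d ?S ?p opt_psi" by (rule opt_valid[OF q d])
  then have psum: "(\<Sum>(x, y)\<in>?S. ?p x y) = 1" by (simp add: valid_ensemble_def)
  have S: "?S = {..<d} \<times> {..<d}" by (simp add: opt_S_def lessThan_atLeast0)
  have HB: "H_B d k ?S ?p opt_psi = ?U"
  proof -
    have "vN_entropy (occ d k) (\<lambda>m m'. \<Sum>z\<in>?S. of_real (case_prod ?p z) * cloner_out d k (case_prod opt_psi z) m m') = ?U"
    proof (rule vN_entropy_cloner[OF _ k])
      show "orthonormal_on {..<d} {..<d} (\<lambda>i. opt_psi 0 i)"
        using orthonormal_opt_psi[of "\<lambda>i. i" d 0] by simp
      fix a b
      have "(\<Sum>z\<in>?S. of_real (case_prod ?p z) * case_prod opt_psi z a * cnj (case_prod opt_psi z b))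
        = (\<Sum>x<d. \<Sum>j<d. of_real (q (cyc d x j) / real d) * opt_psi 0 j a * cnj (opt_psi 0 j b))"
        unfolding S sum.cartesian_product
        by (intro sum.cong refl) (auto simp: opt_p_simplex[OF q d] opt_psi_def split_def)
      also have "\<dots> = (\<Sum>j<d. of_real ((\<Sum>x<d. q (cyc d x j)) / real d) * opt_psi 0 j a * cnj (opt_psi 0 j b))"
        by (subst sum.swap) (simp add: sum_divide_distrib sum_distrib_right)
      also have "\<dots> = (\<Sum>j<d. of_real (1 / real d) * opt_psi 0 j a * cnj (opt_psi 0 j b))"
        by (simp add: sum_cyc_left[OF d] sum_simplex[OF q])
      finally show "(\<Sum>z\<in>?S. of_real (case_prod ?p z) * case_prod opt_psi z a * cnj (case_prod opt_psi z b))
        = (\<Sum>j<d. of_real (1 / real d) * opt_psi 0 j a * cnj (opt_psi 0 j b))" .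
    qed
    then show ?thesis by (simp add: H_B_def avg_state_def[abs_def] split_def)
  qed
  have "(\<Sum>(x, y)\<in>?S. ?p x y * vN_entropy (occ d k) (cloner_out d k (opt_psi x y))) = (\<Sum>(x, y)\<in>?S. ?p x y * ?h)"
    using valid_ensemble_D[OF val] vN_entropy_cloner_pure[OF d k] by (intro sum.cong refl) auto
  also have "\<dots> = (\<Sum>(x, y)\<in>?S. ?p x y) * ?h"
    by (simp add: split_def sum_distrib_right)
  finally have I: "I_XY_B d k ?S ?p opt_psi = ?U - ?h"
    by (simp add: I_XY_B_def psum HB)
  have slice: "{y. (x, y) \<in> ?S} = {..<d}" if "x < d" for x using that by (auto simp: S)
  have marg: "marg_X ?S ?p x = 1 / real d" if "x < d" for x
    using sum_cyc[OF d, of "\<lambda>_ i. q i / real d" x] sum_simplex[OF q]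
    by (simp add: marg_X_def slice[OF that] opt_p_simplex[OF q d] flip: sum_divide_distrib)
  have cond: "vN_entropy (occ d k) (cond_state ?S ?p opt_psi (cloner_out d k) x) = cloner_entropy d k q"
    "vN_entropy (occ d (k - 1)) (cond_state ?S ?p opt_psi (compl_out d k) x) = compl_entropy d k q"
    if x: "x < d" for x
  proof -
    \<comment> \<open>Mode i is the basis vector at i + x modulo d, so that the eigenvalue belonging
      to index i is q i for every x.\<close>
    let ?v = "\<lambda>i. opt_psi x ((i + x) mod d)"
    have w: "?p x y / marg_X ?S ?p x = q (cyc d x y)" for y
      using d by (simp add: marg[OF x] opt_p_simplex[OF q d])
    have v: "orthonormal_on {..<d} {..<d} ?v"
    proof (rule orthonormal_opt_psi)
      show "inj_on (\<lambda>i. (i + x) mod d) {..<d}"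
        by (rule inj_on_inverseI[of _ "cyc d x"]) (simp add: cyc_shift)
    qed (use d in auto)
    have eq: "(\<Sum>y<d. complex_of_real (q (cyc d x y)) * opt_psi x y a * cnj (opt_psi x y b))
       = (\<Sum>i<d. of_real (q i) * ?v i a * cnj (?v i b))" for a b
      by (rule sum_cyc[OF d])
    show "vN_entropy (occ d k) (cond_state ?S ?p opt_psi (cloner_out d k) x) = cloner_entropy d k q"
      unfolding cond_state_def[abs_def] slice[OF x] w by (rule vN_entropy_cloner[OF v k eq])
    show "vN_entropy (occ d (k - 1)) (cond_state ?S ?p opt_psi (compl_out d k) x) = compl_entropy d k q"
      unfolding cond_state_def[abs_def] slice[OF x] w by (rule vN_entropy_compl[OF v k eq])
  qed
  have fst: "fst ` ?S = {..<d}" using d by (auto simp: S image_iff)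
  have "H_B_X d k ?S ?p opt_psi = cloner_entropy d k q" "H_E_X d k ?S ?p opt_psi = compl_entropy d k q"
    using d by (simp_all add: H_B_X_def H_E_X_def fst marg cond cond[unfolded One_nat_def])
  then show ?thesis by (simp add: pd_objective_def I HB algebra_simps)
qed

theorem theorem6:
  fixes d k :: nat and lam mu :: real
  assumes "d \<ge> 2" and "k \<ge> 1" and "lam \<ge> 0" and "mu \<ge> 0"
  shows "\<exists>\<nu> :: nat \<Rightarrow> real.
           (\<forall>m\<in>{1..<d}. \<nu> m \<ge> 0) \<and> (\<Sum>m\<in>{1..<d}. \<nu> m) \<le> 1 \<and>
           valid_ensemble d (opt_S d) (opt_p d \<nu>) opt_psi \<and>
           (\<forall>S p psi. valid_ensemble d S p psi \<longrightarrow>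
              pd_objective d k lam mu S p psi
                \<le> pd_objective d k lam mu (opt_S d) (opt_p d \<nu>) opt_psi)"
proof -
  have d: "d \<ge> 1" using assms by simp
  let ?G = "\<lambda>q. lam * cloner_entropy d k q - (lam + mu) * compl_entropy d k q"
  have "continuous_on (simplex d) ?G"
    by (intro continuous_intros continuous_on_cloner_entropy continuous_on_compl_entropy)
  moreover have "simplex d \<noteq> {}" using simplex_indicator[of 0 d] d by auto
  ultimately obtain q where q: "q \<in> simplex d" and max: "\<forall>r\<in>simplex d. ?G r \<le> ?G q"
    using continuous_attains_sup[OF compact_simplex] by blast
  have "{..<d} = insert 0 {1..<d}" using d by auto
  \<comment> \<open>The slack in the required inequality is the nonnegative weight q 0.\<close>
  then have "q 0 + (\<Sum>i\<in>{1..<d}. q i) = 1" using sum_simplex[OF q] by simp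
  then have "(\<Sum>m\<in>{1..<d}. q m) \<le> 1" using simplex_nonneg[OF q, of 0] d by simp
  moreover have "\<forall>m\<in>{1..<d}. q m \<ge> 0" using simplex_nonneg[OF q] by simp
  moreover have "pd_objective d k lam mu S p psi \<le> pd_objective d k lam mu (opt_S d) (opt_p d q) opt_psi"
    if "valid_ensemble d S p psi" for S p psi
    unfolding pd_objective_opt[OF q d assms(2)]
    using that d assms(2,4) max by (intro pd_objective_le) auto
  ultimately show ?thesis using opt_valid[OF q d] by blast
qed

end
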